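(* Consider the charged-particle equation $\ddot x=\dot x\times B(x)+E(x)$ in $\mathbb{R}^3$ with $B(x)=\frac1\varepsilon B_0+B_1(x)$, $|B_0|=1$, $0<\varepsilon\ll1$, where the fields have the form $$B_1(x)=B_1(x_\perp)+\varepsilon B_2(x),\qquad E(x)=E_\perp(x_\perp)+E_\parallel(x)+\varepsilon E_2(x),$$ with $E_\perp\cdot B_0=0$ and $E_\parallel\times B_0=0$, and where the functions $B_1,B_2,E_\perp,E_\parallel,E_2$ on the right-hand sides and all their derivatives are bounded independently of $\varepsilon$. Let $x^n$ be the numerical solution of the Boris algorithm (defined in the context) with step size $h$ satisfying $\varepsilon\le h^2\ll1$, with starting position $x^0=x(0)$ or $x^0=x(0)+\varepsilon\dot x(0)\times B_0$, where $x(0),\dot x(0)$ are bounded independently of $\varepsilon$, and with a starting velocity $v^0$ that is bounded independently of $\varepsilon$ and $h$ and whose component $v^0_\perp=P_\perp v^0$ satisfies $|v^0_\perp|\le c_1\varepsilon$ with $c_1$ independent of $\varepsilon$ and $h$. Provided that $x^n$ stays in a compact set $K$ for $0\le nh\le c\,\varepsilon^{-1}$ (with $K$ and $c$ independent of $\varepsilon$ and $h$), the solution $y_\perp(t)$ of the initial value problem for the slow differential equation $$\dot y_\perp(t)=\varepsilon E_\perp(y_\perp(t))\times B_0,\qquad y_\perp(0)=x_\perp(0),$$ remains $O(h^2)$-close to the perpendicular component of $x^n$ over times $O(\varepsilon^{-1})$: $$|x^n_\perp-y_\perp(t_n)|\le Ch^2,\qquad 0\le t_n=nh\le c/\varepsilon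 .$$ The constant $C$ is independent of $\varepsilon$, $h$ and $n$ with $0\le nh\le c/\varepsilon$, but depends on the initial velocity bound, on bounds of derivatives of $B_1$ and $E$ on the compact set $K$, and on $c$.
   Context: $B_0\in\mathbb{R}^3$ is a fixed unit vector. $P_\parallel=B_0B_0^\top$, $P_\perp=I-P_\parallel$, and $x\in\mathbb{R}^3$ is decomposed as $x=x_\parallel+x_\perp$ with $x_\parallel=P_\parallel x$, $x_\perp=P_\perp x$. The notation $B_1(x_\perp)$ on the right-hand side denotes (by slight abuse of notation) a function depending only on $x_\perp$. All fields are smooth. The standing step-size regime is $0<\varepsilon\le h^2\ll1$ (i.e. $h$ is at most a sufficiently small constant independent of $\varepsilon$). Boris algorithm (two-step form), with $B^n=B(x^n)$, $E^n=E(x^n)$: $$\frac{x^{n+1}-2x^n+x^{n-1}}{h^2}=\frac{x^{n+1}-x^{n-1}}{2h}\times B^n+E^n,\qquad v^n=\frac{x^{n+1}-x^{n-1}}{2h};$$ it is started from $x^0,v^0$ by determining $x^1,x^{-1}$ from these two relations for $n=0$. *)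

theory Defs
  imports "HOL-Analysis.Analysis"
begin

(* The projections B0 B0^T and I - B0 B0^T, for a unit vector B0. *)

definition P_par :: "real^3 \<Rightarrow> real^3 \<Rightarrow> real^3" where
  "P_par B0 x = (B0 \<bullet> x) *\<^sub>R B0"

definition P_perp :: "real^3 \<Rightarrow> real^3 \<Rightarrow> real^3" where
  "P_perp B0 x = x - P_par B0 x"

(* A function of the perpendicular component only is encoded as a function on the whole space
   that is invariant under translations along B0. *)

definition perp_only :: "real^3 \<Rightarrow> (real^3 \<Rightarrow> real^3) \<Rightarrow> bool" where
  "perp_only B0 F \<longleftrightarrow> (\<forall>x. F x = F (P_perp B0 x))"

(* For smooth f, iter_deriv f [v1, ..., vk] x is the k-th derivative of f at x, a symmetric
   k-linear map, evaluated at (v1, ..., vk). *)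

primrec iter_deriv ::
    "('a::real_normed_vector \<Rightarrow> 'b::real_normed_vector) \<Rightarrow> 'a list \<Rightarrow> 'a \<Rightarrow> 'b" where
  "iter_deriv f [] = f"
| "iter_deriv f (v # vs) = (\<lambda>x. frechet_derivative (iter_deriv f vs) (at x) v)"

definition smooth :: "('a::euclidean_space \<Rightarrow> 'b::real_normed_vector) \<Rightarrow> bool" where
  "smooth f \<longleftrightarrow> (\<forall>vs x. iter_deriv f vs differentiable (at x))"

(* On S, the multilinear operator norm of the k-th derivative is at most M k (k = 0 included). *)

definition derivs_bounded_on ::
    "'a::euclidean_space set \<Rightarrow> (nat \<Rightarrow> real) \<Rightarrow> ('a \<Rightarrow> 'b::real_normed_vector) \<Rightarrow> bool" where
  "derivs_bounded_on S M f \<longleftrightarrow>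
     (\<forall>x\<in>S. \<forall>vs. norm (iter_deriv f vs x) \<le> M (length vs) * prod_list (map norm vs))"

definition closed_nbhd :: "real \<Rightarrow> 'a::metric_space set \<Rightarrow> 'a set" where
  "closed_nbhd \<delta> K = (\<Union>p\<in>K. cball p \<delta>)"

(* B1 and Eperp depend on the perpendicular component only; B2, Epar, E2 are arbitrary. *)

definition admissible_fields ::
    "real^3 \<Rightarrow> (real^3) set \<Rightarrow> (nat \<Rightarrow> real) \<Rightarrow> (real^3 \<Rightarrow> real^3) \<Rightarrow> (real^3 \<Rightarrow> real^3)
      \<Rightarrow> (real^3 \<Rightarrow> real^3) \<Rightarrow> (real^3 \<Rightarrow> real^3) \<Rightarrow> (real^3 \<Rightarrow> real^3) \<Rightarrow> bool" where
  "admissible_fields B0 S M B1 B2 Eperp Epar E2 \<longleftrightarrow>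
     (\<forall>F \<in> {B1, B2, Eperp, Epar, E2}. smooth F \<and> derivs_bounded_on S M F) \<and>
     perp_only B0 B1 \<and> perp_only B0 Eperp \<and>
     (\<forall>x. Eperp x \<bullet> B0 = 0) \<and> (\<forall>x. cross3 (Epar x) B0 = 0)"

definition magnetic_field ::
    "real \<Rightarrow> real^3 \<Rightarrow> (real^3 \<Rightarrow> real^3) \<Rightarrow> (real^3 \<Rightarrow> real^3) \<Rightarrow> real^3 \<Rightarrow> real^3" where
  "magnetic_field \<epsilon> B0 B1 B2 x = (1 / \<epsilon>) *\<^sub>R B0 + (B1 x + \<epsilon> *\<^sub>R B2 x)"

definition electric_field ::
    "real \<Rightarrow> (real^3 \<Rightarrow> real^3) \<Rightarrow> (real^3 \<Rightarrow> real^3) \<Rightarrow> (real^3 \<Rightarrow> real^3) \<Rightarrow> real^3 \<Rightarrow> real^3" where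
  "electric_field \<epsilon> Eperp Epar E2 x = Eperp x + Epar x + \<epsilon> *\<^sub>R E2 x"

(* Numerical positions are indexed by int, since the two-step form uses x^(-1); only the
   values with index \<ge> -1 are constrained. *)

definition boris_velocity :: "real \<Rightarrow> (int \<Rightarrow> real^3) \<Rightarrow> int \<Rightarrow> real^3" where
  "boris_velocity h x n = (1 / (2 * h)) *\<^sub>R (x (n + 1) - x (n - 1))"

definition boris_solution ::
    "real \<Rightarrow> (real^3 \<Rightarrow> real^3) \<Rightarrow> (real^3 \<Rightarrow> real^3) \<Rightarrow> real^3 \<Rightarrow> real^3
      \<Rightarrow> (int \<Rightarrow> real^3) \<Rightarrow> bool" where
  "boris_solution h B E x0 v0 x \<longleftrightarrow>
     x 0 = x0 \<and> boris_velocity h x 0 = v0 \<and>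
     (\<forall>n\<ge>0. (1 / h\<^sup>2) *\<^sub>R (x (n + 1) - 2 *\<^sub>R x n + x (n - 1))
             = cross3 (boris_velocity h x n) (B (x n)) + E (x n))"

definition slow_solution ::
    "real \<Rightarrow> real^3 \<Rightarrow> (real^3 \<Rightarrow> real^3) \<Rightarrow> real^3 \<Rightarrow> real \<Rightarrow> (real \<Rightarrow> real^3) \<Rightarrow> bool" where
  "slow_solution \<epsilon> B0 Eperp y0 T y \<longleftrightarrow>
     y 0 = y0 \<and>
     (\<forall>t\<in>{0..T}. (y has_vector_derivative \<epsilon> *\<^sub>R cross3 (Eperp (y t)) B0) (at t within {0..T}))"

end

theory Submission
  imports Defs
begin

text \<open>Write \<open>u\<close> and \<open>w\<close> for the perpendicular and parallel components of the half-step velocities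
  \<open>V n = (X (n+1) - X n) / h\<close>. Since \<open>h / \<epsilon>\<close> is large, \<open>u\<close> nearly changes sign in every step; after
  subtraction of the slowly varying part \<open>\<epsilon> (w \<beta> + Ep) \<times> B0\<close> with \<open>\<beta> = B0 \<times> B1\<close>, the remainder
  satisfies a Cayley recurrence whose inverse gains a factor \<open>\<epsilon> / h\<close>, and Gronwall's lemma yields
  \<open>u = O(h)\<close> and mean velocities \<open>O(\<epsilon>)\<close> over times \<open>O(1 / \<epsilon>)\<close>. The parallel velocity stays bounded
  because the parallel position and acceleration are (a discrete Landau inequality). Finally the
  drift caused by \<open>w \<beta>\<close> is removed by summation by parts, as \<open>\<beta>\<close> depends on the perpendicular
  position only, and what remains is a perturbed Euler method for the slow equation.\<close>

section \<open>Discrete and continuous growth estimates\<close>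

text \<open>Two circularities shape the proof. Bounding \<open>u\<close> needs \<open>w\<close>
  bounded, bounding \<open>w\<close> needs a small perpendicular mean velocity, and that needs crude
  bounds on both; the energy identity alone allows growth linear in time, useless at times
  \<open>1 / \<epsilon>\<close>. \<open>stability\<close> therefore uses energy for one step at a
  time, and the sharper arguments restore the former bound. Likewise the fields are controlled only
  near \<open>K\<close>, so existence of the slow solution is coupled to the error bound: a cut-off
  equation is solved, and its solution stays near the numerical positions, where the cut-off does
  not act. The order \<open>h^2\<close> has this origin: the starting half step leaves a
  perpendicular velocity of size \<open>h\<close> that is not damped, so positions oscillate by
  about \<open>h * h\<close>. The assumption \<open>\<epsilon> \<le> h^2\<close> enters mostly as
  \<open>\<epsilon> / h \<le> h\<close>. \<open>A\<close> majorises all data, and the later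
  constants are functions of \<open>A\<close> alone, hence independent of \<epsilon> and
  \<open>h\<close>.\<close>

lemma norm_cross3_le: "norm (cross3 x y) \<le> norm x * norm y"
proof (rule power2_le_imp_le)
  show "(norm (cross3 x y))\<^sup>2 \<le> (norm x * norm y)\<^sup>2"
    by (simp add: norm_cross power_mult_distrib)
qed simp

lemma norm_cross3_le_mult:
  "norm x \<le> a \<Longrightarrow> norm y \<le> b \<Longrightarrow> norm (cross3 x y) \<le> a * b"
  by (rule order_trans [OF norm_cross3_le]) (meson mult_mono norm_ge_zero order_trans)

lemma discrete_gronwall:
  fixes a :: "nat \<Rightarrow> real"
  assumes "\<And>n. n < N \<Longrightarrow> a (Suc n) \<le> (1 + p) * a n + q" and "0 \<le> p" "0 \<le> q" "0 \<le> a 0"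
  shows "a N \<le> exp (real N * p) * (a 0 + real N * q)"
proof -
  have "a n \<le> exp (real n * p) * (a 0 + real n * q)" if "n \<le> N" for n
    using that
  proof (induction n)
    case (Suc n)
    let ?b = "a 0 + real n * q"
    have "a (Suc n) \<le> (1 + p) * (exp (real n * p) * ?b) + q"
      using Suc assms by (smt (verit) Suc_leD Suc_le_lessD mult_left_mono)
    also have "\<dots> \<le> exp p * (exp (real n * p) * ?b) + exp (real (Suc n) * p) * q"
    proof (intro add_mono mult_right_mono)
      show "1 + p \<le> exp p" by (rule exp_ge_add_one_self)
      show "q \<le> exp (real (Suc n) * p) * q"
        using assms by (intro mult_le_cancel_right1 [THEN iffD2]) auto
    qed (use assms in auto)
    also have "\<dots> = exp (real (Suc n) * p) * (a 0 + real (Suc n) * q)"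
      by (simp add: algebra_simps exp_add)
    finally show ?case .
  qed (use assms in auto)
  then show ?thesis by simp
qed

text \<open>Absorbs an implicit term: the remainder estimate has the new value on both sides, and
  division by \<open>1 - \<theta>\<close>, at least \<open>1 / 2\<close>, makes the step
  explicit.\<close>

lemma perturbed_step_le:
  fixes y y' :: real
  assumes "y' \<le> y + \<theta> * (y' + y) + g" "0 \<le> \<theta>" "\<theta> \<le> 1 / 2" "0 \<le> y" "0 \<le> g"
  shows "y' \<le> (1 + 4 * \<theta>) * y + 2 * g"
proof -
  have "(1 - \<theta>) * y' \<le> (1 + \<theta>) * y + g"
    using assms(1) by (simp add: algebra_simps)
  also have "\<dots> \<le> (1 - \<theta>) * ((1 + 4 * \<theta>) * y + 2 * g)"
  proof -
    have "0 \<le> (2 * \<theta> * (1 - 2 * \<theta>)) * y + g * (1 - 2 * \<theta>)"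
      using assms by (intro add_nonneg_nonneg mult_nonneg_nonneg) auto
    then show ?thesis by (simp add: algebra_simps)
  qed
  finally show ?thesis using assms by (simp add: mult_le_cancel_left)
qed

text \<open>Backward Taylor expansion over a window of about unit time: the mean velocity there is
  at most \<open>2 * a\<close> over the window length, and \<open>w n\<close> differs from that mean
  by at most \<open>b\<close>. Before a full window has passed, \<open>w 0\<close> takes
  over.\<close>

lemma discrete_landau:
  fixes \<xi> w :: "nat \<Rightarrow> real"
  assumes \<xi>: "\<And>k. k < n \<Longrightarrow> \<xi> (Suc k) - \<xi> k = h * w k" and a: "\<And>k. k \<le> n \<Longrightarrow> \<bar>\<xi> k\<bar> \<le> a"
    and b: "\<And>k. k < n \<Longrightarrow> \<bar>w (Suc k) - w k\<bar> \<le> h * b" and h: "0 < h" "h \<le> 1 / 2" and "0 \<le> b"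
  shows "\<bar>w n\<bar> \<le> max (\<bar>w 0\<bar> + b) (4 * a + b)"
proof -
  have diff: "\<bar>w n - w (n - i)\<bar> \<le> real i * (h * b)" if "i \<le> n" for i
    using that
  proof (induction i)
    case (Suc i)
    have "Suc (n - Suc i) = n - i" using Suc by simp
    with b [of "n - Suc i"] Suc have "\<bar>w (n - i) - w (n - Suc i)\<bar> \<le> h * b" by simp
    with Suc show ?case by (simp add: distrib_right)
  qed simp
  \<comment> \<open>The number of steps in unit time. As \<open>h \<le> 1 / 2\<close>, the window
    has length at least \<open>1 / 2\<close>, which turns \<open>2 * a\<close> into
    \<open>4 * a\<close>.\<close>
  define j where "j = nat \<lfloor>1 / h\<rfloor>"
  have "real j \<le> 1 / h" "1 / h < real j + 1"
    using h unfolding j_def by (auto simp: floor_correct)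
  then have jh: "real j * h \<le> 1" "1 / 2 \<le> real j * h"
    using h by (auto simp: field_simps)
  have small: "real i * (h * b) \<le> b" if "i \<le> j" for i
  proof -
    have "real i * h \<le> real j * h" using that h by simp
    with jh have "real i * h \<le> 1" by linarith
    from mult_right_mono [OF this \<open>0 \<le> b\<close>] show ?thesis by (simp add: mult.assoc)
  qed
  show ?thesis
  proof (cases "n \<le> j")
    case True
    with diff [of n] small [of n] show ?thesis by simp
  next
    case False
    have "\<bar>\<xi> n - \<xi> (n - i) - real i * h * w n\<bar> \<le> real i * h * b" if "i \<le> j" for i
      using that
    proof (induction i)
      case (Suc i)
      have "Suc (n - Suc i) = n - i" using Suc False by simp
      with \<xi> [of "n - Suc i"] Suc False
      have 1: "\<xi> (n - i) - \<xi> (n - Suc i) = h * w (n - Suc i)" by simp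
      have "\<bar>w n - w (n - Suc i)\<bar> \<le> b"
        using diff [of "Suc i"] small [of "Suc i"] Suc False by simp
      then have "\<bar>h * w n - h * w (n - Suc i)\<bar> \<le> h * b"
        using h by (simp flip: right_diff_distrib add: abs_mult)
      with 1 Suc show ?case by (simp add: distrib_right)
    qed simp
    from this [of j] have "\<bar>real j * h * w n\<bar> \<le> 2 * a + real j * h * b"
      using a [of n] a [of "n - j"] by simp
    then have "real j * h * \<bar>w n\<bar> \<le> 2 * a + real j * h * b"
      using h by (simp add: abs_mult)
    moreover have "2 * a \<le> real j * h * (4 * a)"
      using mult_right_mono [OF jh(2), of "4 * a"] a [of n] by simp
    ultimately have "real j * h * \<bar>w n\<bar> \<le> real j * h * (4 * a + b)"
      unfolding distrib_left by linarith
    then have "\<bar>w n\<bar> \<le> 4 * a + b"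
      using jh by (simp add: mult_le_cancel_left)
    then show ?thesis by simp
  qed
qed

text \<open>First-exit argument: the speed is bounded only inside the ball of radius
  \<open>r\<close>, but at that speed the ball cannot be left by time \<open>b\<close>. It is needed
  because \<open>Ep\<close> is controlled only near \<open>K\<close>.\<close>

lemma confined_solution:
  fixes y :: "real \<Rightarrow> 'a::real_normed_vector"
  assumes der: "\<And>t. t \<in> {a..b} \<Longrightarrow> (y has_vector_derivative y' t) (at t within {a..b})"
    and bound: "\<And>t. t \<in> {a..b} \<Longrightarrow> norm (y t - y a) \<le> r \<Longrightarrow> norm (y' t) \<le> m"
    and m: "0 \<le> m" and r: "m * (b - a) < r" and t: "t \<in> {a..b}"
  shows "norm (y t - y a) \<le> m * (t - a)"
proof -
  have cont: "continuous_on {a..b} y"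
    using der by (meson continuous_on_eq_continuous_within has_vector_derivative_continuous)
  have growth: "norm (y s - y a) \<le> m * (s - a)"
    if s: "s \<in> {a..b}" and le: "\<And>t. t \<in> {a..s} \<Longrightarrow> norm (y t - y a) \<le> r" for s
  proof -
    have "norm (y s - y a) \<le> m * norm (s - a)"
    proof (rule differentiable_bound [OF convex_real_interval(5)])
      fix x assume x: "x \<in> {a..s}"
      then have "(y has_vector_derivative y' x) (at x within {a..s})"
        using s by (intro has_vector_derivative_within_subset [OF der]) auto
      then show "(y has_derivative (\<lambda>h. h *\<^sub>R y' x)) (at x within {a..s})"
        by (simp add: has_vector_derivative_def)
      show "onorm (\<lambda>h. h *\<^sub>R y' x) \<le> m"
        using onorm_scaleR_left [OF bounded_linear_ident, of "y' x"] bound [of x] le [OF x] x s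
        by (simp add: onorm_id)
    qed (use s in auto)
    then show ?thesis using s by simp
  qed
  have "norm (y s - y a) < r" if s: "s \<in> {a..b}" for s
  proof (rule ccontr)
    assume "\<not> norm (y s - y a) < r"
    let ?S = "{s \<in> {a..b}. norm (y s - y a) \<in> {r..}}"
    have ne: "?S \<noteq> {}" using s \<open>\<not> norm (y s - y a) < r\<close> by auto
    have "closed ({a..b} \<inter> (\<lambda>s. norm (y s - y a)) -` {r..})"
      by (intro continuous_closed_preimage continuous_intros cont)
    moreover have "{a..b} \<inter> (\<lambda>s. norm (y s - y a)) -` {r..} = ?S" by auto
    ultimately have cl: "closed ?S" by simp
    have S: "?S \<subseteq> {a..b}" by auto
    then have bd: "bdd_below ?S" by (meson bdd_below_Icc bdd_below_mono)
    define \<tau> where "\<tau> = Inf ?S"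
    have \<tau>: "\<tau> \<in> ?S" unfolding \<tau>_def by (rule closed_contains_Inf [OF ne bd cl])
    have before: "norm (y t - y a) < r" if "t \<in> {a..<\<tau>}" for t
      using cInf_lower [OF _ bd, of t] that \<tau> unfolding \<tau>_def [symmetric] by force
    have "0 \<le> m * (b - a)" using m s by auto
    then have "0 < r" using r by simp
    have "a < \<tau>" using \<tau> \<open>0 < r\<close> by (cases "a = \<tau>") auto
    \<comment> \<open>\<open>growth\<close> asks for the bound on the closed interval, so it is
      passed to the limit from the left at \<tau>.\<close>
    have "norm (y \<tau> - y a) \<le> r"
    proof (rule tendsto_upperbound [where F = "at \<tau> within {a..<\<tau>}"])
      have "continuous (at \<tau> within {a..b}) y"
        using cont \<tau> by (auto simp: continuous_on_eq_continuous_within)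
      then have "continuous (at \<tau> within {a..<\<tau>}) y"
        by (rule continuous_within_subset) (use \<tau> in auto)
      then show "((\<lambda>t. norm (y t - y a)) \<longlongrightarrow> norm (y \<tau> - y a)) (at \<tau> within {a..<\<tau>})"
        by (intro tendsto_intros) (simp add: continuous_within)
      show "\<forall>\<^sub>F t in at \<tau> within {a..<\<tau>}. norm (y t - y a) \<le> r"
        using before unfolding eventually_at_filter by (intro always_eventually) (auto intro: less_imp_le)
      show "at \<tau> within {a..<\<tau>} \<noteq> bot"
        using \<open>a < \<tau>\<close> by (simp add: at_within_eq_bot_iff closure_atLeastLessThan)
    qed
    then have "norm (y \<tau> - y a) \<le> m * (\<tau> - a)"
      using before \<tau> by (intro growth) (auto simp: less_le)
    also have "\<dots> \<le> m * (b - a)" using m \<tau> by (intro mult_left_mono) auto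
    finally show False using r \<tau> by auto
  qed
  then show ?thesis using t by (intro growth) (auto simp: less_imp_le)
qed

section \<open>Projection and rotation about a unit vector\<close>

locale unit_direction =
  fixes B0 :: "real^3"
  assumes norm_B0: "norm B0 = 1"
begin

abbreviation P :: "real^3 \<Rightarrow> real^3" where "P \<equiv> P_perp B0"
abbreviation J :: "real^3 \<Rightarrow> real^3" where "J p \<equiv> cross3 p B0"

lemma B0_B0 [simp]: "B0 \<bullet> B0 = 1"
  using norm_B0 by (simp add: norm_eq_1)

lemma linear_P: "linear P"
  by (rule linearI) (simp_all add: P_perp_def P_par_def algebra_simps inner_simps)

lemmas P_add = linear_add [OF linear_P]
  and P_diff = linear_diff [OF linear_P]
  and P_scaleR = linear_cmul [OF linear_P]
  and P_zero [simp] = linear_0 [OF linear_P]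

lemma linear_J: "linear J"
  by (rule linearI) (simp_all add: cross_add_left cross_mult_left)

lemmas J_add = linear_add [OF linear_J]
  and J_diff = linear_diff [OF linear_J]
  and J_scaleR = linear_cmul [OF linear_J]

lemma B0_P [simp]: "B0 \<bullet> P a = 0" "P a \<bullet> B0 = 0"
  by (simp_all add: P_perp_def P_par_def inner_simps inner_commute)

lemma decomposition: "a = P a + (B0 \<bullet> a) *\<^sub>R B0"
  by (simp add: P_perp_def P_par_def)

lemma P_eq_self: "a \<bullet> B0 = 0 \<Longrightarrow> P a = a"
  by (simp add: P_perp_def P_par_def inner_commute)

lemma P_P [simp]: "P (P a) = P a"
  by (simp add: P_eq_self)

lemma P_J [simp]: "P (J a) = J a"
  by (rule P_eq_self) (simp add: dot_cross_self)

lemma J_P [simp]: "J (P a) = J a"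
  by (simp add: P_perp_def P_par_def Cross3.left_diff_distrib cross_mult_left)

text \<open>\<open>J\<close> is a quarter turn of the plane orthogonal to \<open>B0\<close> and
  kills \<open>B0\<close>. Hence the singular rotation \<open>(1 / \<epsilon>) *\<^sub>R J v\<close>
  is inverted on that plane by \<open>- \<epsilon> *\<^sub>R J\<close>, the source of later factors
  \<epsilon>.\<close>

lemma J_J [simp]: "J (J a) = - P a"
  by (simp add: cross_skew [of _ B0] Lagrange P_perp_def P_par_def inner_commute)

lemma P_cross3_B0 [simp]: "P (cross3 B0 a) = cross3 B0 a"
  by (rule P_eq_self) (simp add: dot_cross_self)

lemma norm_P_le: "norm (P a) \<le> norm a"
proof (rule power2_le_imp_le)
  have "(norm (P a))\<^sup>2 = (norm a)\<^sup>2 - (B0 \<bullet> a)\<^sup>2"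
    unfolding power2_norm_eq_inner P_perp_def P_par_def inner_simps
    by (simp add: inner_commute power2_eq_square)
  then show "(norm (P a))\<^sup>2 \<le> (norm a)\<^sup>2" by simp
qed simp

lemma norm_J [simp]: "norm (J a) = norm (P a)"
proof -
  have "(norm (J (P a)))\<^sup>2 = (norm (P a))\<^sup>2"
    by (simp add: norm_cross norm_B0 del: J_P)
  then show ?thesis by simp
qed

lemma norm_J_le: "norm (J a) \<le> norm a"
  by (simp add: norm_P_le)

lemma abs_B0_le: "\<bar>B0 \<bullet> a\<bar> \<le> norm a"
  using Cauchy_Schwarz_ineq2 [of B0 a] by (simp add: norm_B0)

lemma norm_le_split: "norm a \<le> norm (P a) + \<bar>B0 \<bullet> a\<bar>"
proof -
  have "norm a \<le> norm (P a) + norm ((B0 \<bullet> a) *\<^sub>R B0)"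
    by (metis decomposition norm_triangle_ineq)
  then show ?thesis by (simp add: norm_B0)
qed

text \<open>On the plane, the identity plus or minus \<kappa> times \<open>J\<close> multiplies
  norms by the same \<open>sqrt (1 + \<kappa>\<^sup>2)\<close>, since \<open>J a\<close> is
  orthogonal to \<open>a\<close>. So the homogeneous step is an isometry, and the forcing is divided
  by at least \<kappa>; with \<kappa> equal to \<open>h / (2 * \<epsilon>)\<close> a forcing
  \<open>h *\<^sub>R \<rho> n\<close> costs only
  \<open>2 * \<epsilon> * norm (\<rho> n)\<close>.\<close>

lemma norm_cayley_step:
  assumes eq: "r - r' = \<kappa> *\<^sub>R J (r + r') + g" and r: "P r = r" "P r' = r'" and \<kappa>: "\<kappa> > 0"
  shows "norm r \<le> norm r' + norm g / \<kappa>"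
proof -
  have sq: "(norm (a + c *\<^sub>R J a))\<^sup>2 = (1 + c\<^sup>2) * (norm a)\<^sup>2" if "P a = a" for a and c :: real
  proof -
    have "(norm (a + c *\<^sub>R J a))\<^sup>2 = (norm a)\<^sup>2 + c\<^sup>2 * (norm (J a))\<^sup>2"
      unfolding power2_norm_eq_inner
      by (simp add: inner_simps dot_cross_self power2_eq_square algebra_simps)
    then show ?thesis using that by (simp add: algebra_simps)
  qed
  have nrm: "norm (a + c *\<^sub>R J a) = sqrt (1 + c\<^sup>2) * norm a" if "P a = a" for a and c :: real
  proof (rule power2_eq_imp_eq)
    show "(norm (a + c *\<^sub>R J a))\<^sup>2 = (sqrt (1 + c\<^sup>2) * norm a)\<^sup>2"
      by (simp add: sq [OF that] power_mult_distrib)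
  qed auto
  have "r + (- \<kappa>) *\<^sub>R J r = (r' + \<kappa> *\<^sub>R J r') + g"
    using eq by (simp add: J_add algebra_simps)
  then have "norm (r + (- \<kappa>) *\<^sub>R J r) \<le> norm (r' + \<kappa> *\<^sub>R J r') + norm g"
    by (metis norm_triangle_ineq)
  then have "sqrt (1 + \<kappa>\<^sup>2) * norm r \<le> sqrt (1 + \<kappa>\<^sup>2) * norm r' + norm g"
    unfolding nrm [OF r(1)] nrm [OF r(2)] by simp
  moreover have k: "\<kappa> \<le> sqrt (1 + \<kappa>\<^sup>2)" by (rule real_le_rsqrt) simp
  moreover have "norm g \<le> sqrt (1 + \<kappa>\<^sup>2) * (norm g / \<kappa>)"
    using mult_right_mono [OF k, of "norm g / \<kappa>"] \<kappa> by simp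
  ultimately have "sqrt (1 + \<kappa>\<^sup>2) * norm r \<le> sqrt (1 + \<kappa>\<^sup>2) * (norm r' + norm g / \<kappa>)"
    by (simp add: distrib_left)
  moreover have "0 < sqrt (1 + \<kappa>\<^sup>2)" using \<kappa> k by linarith
  ultimately show ?thesis by (simp only: mult_le_cancel_left_pos)
qed

text \<open>The parallel velocity contributes a multiple of \<open>cross3 B0 b\<close>, orthogonal
  to \<open>B0\<close>; the magnetic part of the parallel acceleration is thus controlled by the
  perpendicular velocity.\<close>

lemma B0_cross3: "B0 \<bullet> cross3 v b = B0 \<bullet> cross3 (P v) b"
proof -
  have "cross3 v b = cross3 (P v) b + (B0 \<bullet> v) *\<^sub>R cross3 B0 b"
    by (metis decomposition cross_add_left cross_mult_left)
  then show ?thesis by (simp add: inner_simps dot_cross_self)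
qed

lemma P_cross3: "P (cross3 v b) = P (cross3 (P v) b) + (B0 \<bullet> v) *\<^sub>R cross3 B0 b"
proof -
  have "cross3 v b = cross3 (P v) b + (B0 \<bullet> v) *\<^sub>R cross3 B0 b"
    by (metis decomposition cross_add_left cross_mult_left)
  then show ?thesis by (simp add: P_add P_scaleR)
qed

end

section \<open>Long-time stability of the numerical velocities\<close>

text \<open>One constant per stage: \<open>rem_const\<close> for the forcing \<rho>,
  \<open>vel_const\<close> for \<open>u\<close> over \<open>h\<close>, \<open>drift_const\<close>
  for the perpendicular mean velocity over \<epsilon>, \<open>error_const\<close> for the final
  error over \<open>h\<^sup>2\<close>. The 224 is \<open>2 * (18 + 13 + 81)\<close> from
  \<open>norm_\<rho>_le\<close>; the exponentials are Gronwall factors. \<open>drift_const\<close>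
  is generous so that \<open>h * drift_const A \<le> 1\<close> also yields
  \<open>h_small\<close>.\<close>

definition rem_const :: "real \<Rightarrow> real" where "rem_const A = 224 * A ^ 4"
definition vel_const :: "real \<Rightarrow> real" where "vel_const A = 6 * rem_const A * A * exp (8 * rem_const A * A)"
definition drift_const :: "real \<Rightarrow> real" where "drift_const A = 6 * rem_const A * vel_const A"
definition error_const :: "real \<Rightarrow> real" where "error_const A = 24 * A ^ 3 * drift_const A * exp (A * A)"

text \<open>One run in half-step form. \<open>B1\<close> and \<open>Ep\<close> are also estimated
  outside \<open>K\<close> (after the last admissible step and along the slow solution), so their
  bounds refer to the perpendicular distance to a point of \<open>K\<close>; \<open>B2\<close>,
  \<open>Epar\<close> and \<open>E2\<close> are estimated on \<open>K\<close> only. The 18 in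
  \<open>small\<close> ensures that one step at a velocity of at most \<open>18 * A\<close> moves by
  at most \<delta>.\<close>

locale boris_run = unit_direction B0 for B0 :: "real^3" +
  fixes K :: "(real^3) set" and \<delta> c A \<epsilon> h :: real
    and B1 B2 Ep Epar E2 :: "real^3 \<Rightarrow> real^3"
    and X :: "nat \<Rightarrow> real^3" and v0 :: "real^3" and V :: "nat \<Rightarrow> real^3"
  assumes V_diff: "\<And>n. X (Suc n) - X n = h *\<^sub>R V n"
    and A: "1 \<le> A" "c \<le> A" and eps: "0 < \<epsilon>" "\<epsilon> \<le> h\<^sup>2" and h: "0 < h"
    and small: "h * drift_const A \<le> 1" "h * (18 * A) \<le> \<delta>" and \<delta>: "0 < \<delta>"
    and K_le: "\<And>p. p \<in> K \<Longrightarrow> norm p \<le> A"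
    and near_bound: "\<And>F p a. F \<in> {B1, Ep} \<Longrightarrow> p \<in> K \<Longrightarrow> norm (P_perp B0 a - P_perp B0 p) \<le> \<delta>
      \<Longrightarrow> norm (F a) \<le> A"
    and near_lipschitz: "\<And>F p a b. F \<in> {B1, Ep} \<Longrightarrow> p \<in> K \<Longrightarrow> norm (P_perp B0 a - P_perp B0 p) \<le> \<delta>
      \<Longrightarrow> norm (P_perp B0 b - P_perp B0 p) \<le> \<delta>
      \<Longrightarrow> norm (F a - F b) \<le> A * norm (P_perp B0 a - P_perp B0 b)"
    and K_bound: "\<And>F p. F \<in> {B2, Epar, E2} \<Longrightarrow> p \<in> K \<Longrightarrow> norm (F p) \<le> A"
    and Ep_perp: "\<And>a. Ep a \<bullet> B0 = 0" and Epar_par: "\<And>a. cross3 (Epar a) B0 = 0"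
    and in_K: "\<And>n. \<epsilon> * (real n * h) \<le> c \<Longrightarrow> X n \<in> K"
    and c: "0 < c"
    and v0: "norm v0 \<le> A" "norm (P_perp B0 v0) \<le> A * \<epsilon>"
    and init: "V 0 = v0 + (h / 2) *\<^sub>R (cross3 v0 (magnetic_field \<epsilon> B0 B1 B2 (X 0))
                 + electric_field \<epsilon> Ep Epar E2 (X 0))"
    and step: "\<And>n. V (Suc n) - V n
       = h *\<^sub>R (cross3 ((1 / 2) *\<^sub>R (V (Suc n) + V n)) (magnetic_field \<epsilon> B0 B1 B2 (X (Suc n)))
                 + electric_field \<epsilon> Ep Epar E2 (X (Suc n)))"
begin

definition ok :: "nat \<Rightarrow> bool" where "ok n \<longleftrightarrow> \<epsilon> * (real n * h) \<le> c"
text \<open>\<open>V n\<close> lives between the grid points \<open>n\<close> and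
  \<open>n + 1\<close>, so this is the Boris velocity at index \<open>n + 1\<close>; hence
  \<open>step\<close> takes the fields at \<open>X (Suc n)\<close>.\<close>

definition mid :: "nat \<Rightarrow> real^3" where "mid n = (1 / 2) *\<^sub>R (V (Suc n) + V n)"
definition \<beta> :: "real^3 \<Rightarrow> real^3" where "\<beta> p = cross3 B0 (B1 p)"
text \<open>The rest of the perpendicular force once the fast rotation, \<open>Ep\<close> and the
  term proportional to the parallel velocity are taken out. For bounded parallel velocity it is of
  size \<open>norm (P v)\<close> plus \<epsilon>.\<close>

definition g :: "real^3 \<Rightarrow> real^3 \<Rightarrow> real^3" where
  "g p v = P (cross3 (P v) (B1 p)) + \<epsilon> *\<^sub>R P (cross3 v (B2 p)) + \<epsilon> *\<^sub>R P (E2 p)"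

abbreviation "B \<equiv> magnetic_field \<epsilon> B0 B1 B2"
abbreviation "E \<equiv> electric_field \<epsilon> Ep Epar E2"
abbreviation u :: "nat \<Rightarrow> real^3" where "u n \<equiv> P (V n)"
abbreviation w :: "nat \<Rightarrow> real" where "w n \<equiv> B0 \<bullet> V n"

lemma ok_mono:
  assumes "ok n" "m \<le> n"
  shows "ok m"
proof -
  have "\<epsilon> * (real m * h) \<le> \<epsilon> * (real n * h)"
    using eps h assms by (intro mult_left_mono mult_right_mono) auto
  with assms show ?thesis unfolding ok_def by linarith
qed

lemma ok_SucD: "ok (Suc n) \<Longrightarrow> ok n"
  by (rule ok_mono) auto

lemma ok_0: "ok 0"
  using c by (simp add: ok_def)

lemma in_K_ok: "ok n \<Longrightarrow> X n \<in> K"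
  by (simp add: ok_def in_K)

lemma A_pow: "1 \<le> A ^ n" "A \<le> A\<^sup>2" "A\<^sup>2 \<le> A ^ 3" "A ^ 3 \<le> A ^ 4"
  using A one_le_power [of A n] power_increasing [of 1 2 A] power_increasing [of 2 3 A] power_increasing [of 3 4 A]
  by simp_all

lemma const_bounds: "224 \<le> rem_const A" "224 * A ^ 4 = rem_const A" "rem_const A \<le> vel_const A"
  "6 * rem_const A * vel_const A = drift_const A" "1 \<le> vel_const A" "vel_const A \<le> drift_const A"
  "rem_const A \<le> drift_const A" "1 \<le> drift_const A"
proof -
  show 1: "224 \<le> rem_const A" using A_pow(1) [of 4] by (simp add: rem_const_def)
  have "1 * 1 \<le> (6 * A) * exp (8 * rem_const A * A)"
    using A 1 by (intro mult_mono) (auto)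
  with 1 mult_left_mono [OF this, of "rem_const A"] show 2: "rem_const A \<le> vel_const A" by (simp add: vel_const_def mult_ac)
  show "6 * rem_const A * vel_const A = drift_const A" by (simp add: drift_const_def)
  show 3: "1 \<le> vel_const A" using 1 2 by simp
  have "1 * vel_const A \<le> (6 * rem_const A) * vel_const A" using 1 3 by (intro mult_mono) auto
  then show "vel_const A \<le> drift_const A" by (simp add: drift_const_def)
  then show "rem_const A \<le> drift_const A" "1 \<le> drift_const A" using 2 3 by auto
qed (simp add: rem_const_def)

lemma h_small: "h * (6 * rem_const A * vel_const A) \<le> 1" "h * vel_const A \<le> 1" "h * rem_const A \<le> 1 / 6" "h \<le> 1 / 2" "h * A\<^sup>2 \<le> 1 / 224"
  "h * A \<le> 1 / 224"
proof -
  show 1: "h * (6 * rem_const A * vel_const A) \<le> 1" using small by (simp add: drift_const_def)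
  have "h * vel_const A \<le> h * drift_const A" using h const_bounds by (intro mult_left_mono) auto
  then show 2: "h * vel_const A \<le> 1" using small by simp
  have "h * (6 * rem_const A * 1) \<le> h * (6 * rem_const A * vel_const A)" using h const_bounds by (intro mult_left_mono) auto
  with 1 show 3: "h * rem_const A \<le> 1 / 6" by simp
  have "h * 224 \<le> h * rem_const A" using h const_bounds by (intro mult_left_mono) auto
  with 3 show "h \<le> 1 / 2" by simp
  have "h * (224 * A\<^sup>2) \<le> h * rem_const A" using h A_pow unfolding rem_const_def by (intro mult_left_mono) auto
  with 3 show 4: "h * A\<^sup>2 \<le> 1 / 224" by simp
  have "h * A \<le> h * A\<^sup>2" using h A_pow by (intro mult_left_mono) auto
  with 4 show "h * A \<le> 1 / 224" by simp
qed

lemma eps_small: "\<epsilon> \<le> h * h" "\<epsilon> / h \<le> h" "\<epsilon> \<le> h / 2" "\<epsilon> \<le> 1" "\<epsilon> * \<epsilon> \<le> \<epsilon>" "\<epsilon> \<le> h"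
proof -
  show 1: "\<epsilon> \<le> h * h" using eps by (simp add: power2_eq_square)
  then show "\<epsilon> / h \<le> h" using h by (simp add: field_simps)
  have "h * h \<le> h * (1 / 2)" using h h_small by (intro mult_left_mono) auto
  with 1 show 2: "\<epsilon> \<le> h / 2" by simp
  then show 3: "\<epsilon> \<le> 1" using h_small h by simp
  then show "\<epsilon> * \<epsilon> \<le> \<epsilon>" using eps by (simp add: mult_left_le)
  show "\<epsilon> \<le> h" using 2 h by simp
qed

section \<open>Force splitting and crude one-step bounds\<close>

lemma field_bounds:
  assumes "X n \<in> K"
  shows "norm (B1 (X n)) \<le> A" "norm (Ep (X n)) \<le> A" "norm (B2 (X n)) \<le> A"
    "norm (Epar (X n)) \<le> A" "norm (E2 (X n)) \<le> A" "norm (\<beta> (X n)) \<le> A" "norm (E (X n)) \<le> 3 * A"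
proof -
  show 1: "norm (B1 (X n)) \<le> A" and 2: "norm (Ep (X n)) \<le> A"
    using near_bound [of _ "X n" "X n"] assms \<delta> by auto
  show "norm (B2 (X n)) \<le> A" and 3: "norm (Epar (X n)) \<le> A" and 4: "norm (E2 (X n)) \<le> A"
    using K_bound assms by auto
  show "norm (\<beta> (X n)) \<le> A"
    using norm_cross3_le_mult [OF _ 1, of B0 1] by (simp add: \<beta>_def norm_B0)
  have "norm (\<epsilon> *\<^sub>R E2 (X n)) \<le> 1 * A"
    unfolding norm_scaleR using eps eps_small 4 A by (intro mult_mono) auto
  then show "norm (E (X n)) \<le> 3 * A"
    unfolding electric_field_def using norm_triangle_mono [OF norm_triangle_mono [OF 2 3]] by fastforce
qed

lemma P_\<beta> [simp]: "P (\<beta> p) = \<beta> p"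
  by (simp add: \<beta>_def)

lemma P_Ep [simp]: "P (Ep p) = Ep p"
  by (simp add: P_eq_self Ep_perp)

lemma P_Epar [simp]: "P (Epar p) = 0"
  using norm_J [of "Epar p"] by (simp add: Epar_par)

lemma P_force:
  "P (cross3 v (B p) + E p) = (1 / \<epsilon>) *\<^sub>R J v + (Ep p + (B0 \<bullet> v) *\<^sub>R \<beta> p + g p v)"
proof -
  have "cross3 v (B p) = (1 / \<epsilon>) *\<^sub>R J v + (cross3 v (B1 p) + \<epsilon> *\<^sub>R cross3 v (B2 p))"
    by (simp add: magnetic_field_def cross_add_right cross_mult_right)
  then show ?thesis
    by (simp add: electric_field_def P_add P_scaleR P_cross3 [of v "B1 p"] g_def \<beta>_def)
qed

lemma norm_g_le:
  assumes "X n \<in> K"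
  shows "norm (g (X n) v) \<le> 2 * A * norm (P v) + \<epsilon> * A * (1 + \<bar>B0 \<bullet> v\<bar>)"
proof -
  note fb = field_bounds [OF assms]
  have 1: "norm (P (cross3 (P v) (B1 (X n)))) \<le> norm (P v) * A"
    by (rule order_trans [OF norm_P_le norm_cross3_le_mult [OF order_refl fb(1)]])
  have "norm (P (cross3 v (B2 (X n)))) \<le> (norm (P v) + \<bar>B0 \<bullet> v\<bar>) * A"
    by (rule order_trans [OF norm_P_le norm_cross3_le_mult [OF norm_le_split fb(3)]])
  then have 2: "norm (\<epsilon> *\<^sub>R P (cross3 v (B2 (X n)))) \<le> \<epsilon> * ((norm (P v) + \<bar>B0 \<bullet> v\<bar>) * A)"
    using eps by simp
  have 3: "norm (\<epsilon> *\<^sub>R P (E2 (X n))) \<le> \<epsilon> * A"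
    using eps fb order_trans [OF norm_P_le fb(5)] by simp
  have 4: "\<epsilon> * (norm (P v) * A) \<le> 1 * (norm (P v) * A)"
    using eps_small A by (intro mult_right_mono) auto
  have "norm (g (X n) v) \<le> norm (P v) * A + \<epsilon> * ((norm (P v) + \<bar>B0 \<bullet> v\<bar>) * A) + \<epsilon> * A"
    unfolding g_def by (intro norm_triangle_mono 1 2 3)
  then show ?thesis using 4 by (simp add: algebra_simps)
qed

lemma u_step:
  "u (Suc n) - u n = (h / \<epsilon>) *\<^sub>R J (mid n)
     + h *\<^sub>R (Ep (X (Suc n)) + (B0 \<bullet> mid n) *\<^sub>R \<beta> (X (Suc n)) + g (X (Suc n)) (mid n))"
proof -
  have "u (Suc n) - u n = h *\<^sub>R P (cross3 (mid n) (B (X (Suc n))) + E (X (Suc n)))"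
    using arg_cong [OF step [of n], of P] unfolding mid_def by (simp only: P_diff P_scaleR)
  then show ?thesis by (simp add: P_force scaleR_add_right)
qed

text \<open>The singular field drops out because \<open>cross3 v B0\<close> is orthogonal to
  \<open>B0\<close>; each of the four remaining terms is at most \<open>A\<close>.\<close>

lemma w_step:
  assumes "X (Suc n) \<in> K" and s: "norm (P (mid n)) \<le> 1"
  shows "\<bar>w (Suc n) - w n\<bar> \<le> h * (4 * A)"
proof -
  let ?p = "X (Suc n)"
  note fb = field_bounds [OF assms(1)]
  have "w (Suc n) - w n = h * (B0 \<bullet> (cross3 (mid n) (B ?p)) + B0 \<bullet> E ?p)"
    using arg_cong [OF step [of n], of "\<lambda>v. B0 \<bullet> v"] unfolding mid_def by (simp add: inner_simps)
  also have "B0 \<bullet> (cross3 (mid n) (B ?p)) = B0 \<bullet> cross3 (P (mid n)) (B1 ?p)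
               + \<epsilon> * (B0 \<bullet> cross3 (P (mid n)) (B2 ?p))"
    unfolding B0_cross3 [of "mid n"]
    by (simp add: magnetic_field_def cross_add_right cross_mult_right inner_add_right dot_cross_self)
  also have "B0 \<bullet> E ?p = B0 \<bullet> Epar ?p + \<epsilon> * (B0 \<bullet> E2 ?p)"
    using Ep_perp by (simp add: electric_field_def inner_add_right inner_commute)
  finally have eq: "w (Suc n) - w n = h * (B0 \<bullet> cross3 (P (mid n)) (B1 ?p)
      + \<epsilon> * (B0 \<bullet> cross3 (P (mid n)) (B2 ?p)) + (B0 \<bullet> Epar ?p + \<epsilon> * (B0 \<bullet> E2 ?p)))" .
  have scale: "\<bar>\<epsilon> * t\<bar> \<le> A" if "\<bar>t\<bar> \<le> A" for t
    using mult_mono [OF eps_small(4) that] eps by (simp add: abs_mult)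
  have 1: "\<bar>B0 \<bullet> cross3 (P (mid n)) (B1 ?p)\<bar> \<le> A" "\<bar>B0 \<bullet> cross3 (P (mid n)) (B2 ?p)\<bar> \<le> A"
    using norm_cross3_le_mult [OF s fb(1)] norm_cross3_le_mult [OF s fb(3)]
    by (auto intro: order_trans [OF abs_B0_le])
  have 2: "\<bar>B0 \<bullet> Epar ?p\<bar> \<le> A" "\<bar>B0 \<bullet> E2 ?p\<bar> \<le> A"
    using fb by (auto intro: order_trans [OF abs_B0_le])
  have "\<bar>B0 \<bullet> cross3 (P (mid n)) (B1 ?p)
      + \<epsilon> * (B0 \<bullet> cross3 (P (mid n)) (B2 ?p)) + (B0 \<bullet> Epar ?p + \<epsilon> * (B0 \<bullet> E2 ?p))\<bar> \<le> 4 * A"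
    using 1 2 scale [OF 1(2)] scale [OF 2(2)] by linarith
  then show ?thesis
    unfolding eq abs_mult using h by (simp add: mult_left_mono)
qed

text \<open>The magnetic force does no work: paired with \<open>V (Suc n) + V n\<close>, a multiple
  of the velocity in the cross product, only the electric field survives.\<close>

lemma energy_step:
  assumes "X (Suc n) \<in> K"
  shows "norm (V (Suc n)) \<le> norm (V n) + h * (3 * A)"
proof -
  let ?S = "V (Suc n) + V n" and ?e = "E (X (Suc n))"
  have "(norm (V (Suc n)))\<^sup>2 - (norm (V n))\<^sup>2 = (V (Suc n) - V n) \<bullet> ?S"
    by (simp add: power2_norm_eq_inner inner_simps inner_commute)
  also have "\<dots> = h * (?e \<bullet> ?S)"
    unfolding step [of n] by (simp add: inner_add_left cross_mult_left dot_cross_self)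
  also have "\<dots> \<le> h * (3 * A * (norm (V (Suc n)) + norm (V n)))"
  proof (intro mult_left_mono)
    have "?e \<bullet> ?S \<le> norm ?e * norm ?S" by (rule norm_cauchy_schwarz)
    also have "\<dots> \<le> 3 * A * (norm (V (Suc n)) + norm (V n))"
      using field_bounds(7) [OF assms] A by (intro mult_mono norm_triangle_ineq) auto
    finally show "?e \<bullet> ?S \<le> 3 * A * (norm (V (Suc n)) + norm (V n))" .
  qed (use h in simp)
  finally have "(norm (V (Suc n)) - norm (V n)) * (norm (V (Suc n)) + norm (V n))
      \<le> h * (3 * A) * (norm (V (Suc n)) + norm (V n))"
    by (simp add: power2_eq_square algebra_simps)
  moreover have "0 \<le> norm (V (Suc n)) + norm (V n)" "0 \<le> h * (3 * A)"
    using h A by auto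
  ultimately show ?thesis
    by (cases "norm (V (Suc n)) + norm (V n) = 0") (simp_all add: mult_le_cancel_right add_nonneg_eq_0_iff)
qed

text \<open>\<open>u_step\<close> is solved for \<open>J (mid n)\<close>: the jump of
  \<open>u\<close> receives the factor \<open>\<epsilon> / h\<close>, at most \<open>h\<close>, and
  the forces receive \<epsilon>. Crude bounds on \<open>V\<close> then suffice, as
  \<open>h * A\<^sup>2\<close> is small.\<close>

lemma mid_small:
  assumes K: "X (Suc n) \<in> K" and V: "norm (V n) \<le> 18 * A" "norm (V (Suc n)) \<le> 18 * A"
  shows "norm (P (mid n)) \<le> 1"
proof -
  let ?p = "X (Suc n)"
  note fb = field_bounds [OF K]
  have m: "norm (mid n) \<le> 18 * A"
    using V norm_triangle_ineq [of "V (Suc n)" "V n"] by (simp add: mid_def)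
  have mP: "norm (P (mid n)) \<le> 18 * A" and mB: "\<bar>B0 \<bullet> mid n\<bar> \<le> 18 * A"
    using m norm_P_le [of "mid n"] abs_B0_le [of "mid n"] by auto
  have J: "J (mid n) = (\<epsilon> / h) *\<^sub>R (u (Suc n) - u n)
     - \<epsilon> *\<^sub>R (Ep ?p + (B0 \<bullet> mid n) *\<^sub>R \<beta> ?p + g ?p (mid n))"
    unfolding u_step using eps h by (simp add: scaleR_add_right)
  have 1: "norm (u (Suc n) - u n) \<le> 36 * A"
    using V norm_P_le [of "V n"] norm_P_le [of "V (Suc n)"] norm_triangle_ineq4 [of "u (Suc n)" "u n"]
    by linarith
  have 2: "norm ((B0 \<bullet> mid n) *\<^sub>R \<beta> ?p) \<le> 18 * A * A"
    unfolding norm_scaleR using mB fb A by (intro mult_mono) auto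
  have "2 * A * norm (P (mid n)) \<le> 2 * A * (18 * A)"
    using mP A by (intro mult_left_mono) auto
  moreover have "\<epsilon> * A * (1 + \<bar>B0 \<bullet> mid n\<bar>) \<le> 1 * A * (1 + 18 * A)"
    using mB A eps eps_small by (intro mult_mono) auto
  ultimately have 3: "norm (g ?p (mid n)) \<le> A + 54 * A * A"
    using norm_g_le [OF K, of "mid n"] by (simp add: algebra_simps)
  have 4: "norm (Ep ?p + (B0 \<bullet> mid n) *\<^sub>R \<beta> ?p + g ?p (mid n)) \<le> 2 * A + 72 * A * A"
    using 2 3 fb(2) norm_triangle_ineq [of "Ep ?p" "(B0 \<bullet> mid n) *\<^sub>R \<beta> ?p"]
      norm_triangle_ineq [of "Ep ?p + (B0 \<bullet> mid n) *\<^sub>R \<beta> ?p" "g ?p (mid n)"] by linarith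
  have "norm (P (mid n)) = norm (J (mid n))" by simp
  also have "\<dots> \<le> (\<epsilon> / h) * norm (u (Suc n) - u n)
      + \<epsilon> * norm (Ep ?p + (B0 \<bullet> mid n) *\<^sub>R \<beta> ?p + g ?p (mid n))"
    unfolding J using eps h by (intro order_trans [OF norm_triangle_ineq4]) simp
  also have "\<dots> \<le> h * (36 * A) + h * (2 * A + 72 * A * A)"
    using 1 4 eps h eps_small by (intro add_mono mult_mono) auto
  also have "\<dots> \<le> 1"
    using h_small by (simp add: algebra_simps power2_eq_square)
  finally show ?thesis .
qed

text \<open>The assumption on the perpendicular starting velocity enters here: it keeps
  \<open>(1 / \<epsilon>) *\<^sub>R J v0\<close> bounded, so the starting half step contributes only
  \<open>O(h)\<close> to \<open>u 0\<close>.\<close>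

lemma V0_bounds: "norm (u 0) \<le> 4 * A\<^sup>2 * h" "\<bar>w 0\<bar> \<le> 2 * A" 
proof -
  let ?p = "X 0"
  have K: "?p \<in> K" by (simp add: in_K_ok ok_0)
  note fb = field_bounds [OF K]
  have m: "\<bar>B0 \<bullet> v0\<bar> \<le> A" using abs_B0_le [of v0] v0 by simp
  have "u 0 = P v0 + (h / 2) *\<^sub>R ((1 / \<epsilon>) *\<^sub>R J v0 + (Ep ?p + (B0 \<bullet> v0) *\<^sub>R \<beta> ?p + g ?p v0))"
    unfolding init P_add [of v0] P_scaleR P_force ..
  then have 1: "norm (u 0) \<le> norm (P v0) + (h / 2) * norm ((1 / \<epsilon>) *\<^sub>R J v0 + (Ep ?p + (B0 \<bullet> v0) *\<^sub>R \<beta> ?p + g ?p v0))"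
    using h by (simp add: order_trans [OF norm_triangle_ineq])
  have 2: "norm ((1 / \<epsilon>) *\<^sub>R J v0) \<le> A"
    using v0 eps by (simp add: field_simps)
  have 3: "norm ((B0 \<bullet> v0) *\<^sub>R \<beta> ?p) \<le> A * A"
    unfolding norm_scaleR using m fb A by (intro mult_mono) auto
  have "2 * A * norm (P v0) \<le> 2 * A * (A * \<epsilon>)"
    using v0 A by (intro mult_left_mono) auto
  also have "\<dots> \<le> 2 * A * (A * (1/2))"
    using A eps_small h_small by (intro mult_left_mono) auto
  finally have "2 * A * norm (P v0) \<le> A * A" by simp
  moreover have "\<epsilon> * A * (1 + \<bar>B0 \<bullet> v0\<bar>) \<le> 1 * A * (1 + A)"
    using m A eps eps_small by (intro mult_mono) auto
  ultimately have 4: "norm (g ?p v0) \<le> A + 2 * A * A"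
    using norm_g_le [OF K, of "v0"] by (simp add: algebra_simps)
  have "norm ((1 / \<epsilon>) *\<^sub>R J v0 + (Ep ?p + (B0 \<bullet> v0) *\<^sub>R \<beta> ?p + g ?p v0)) \<le> 3 * A + 3 * A * A"
    using norm_triangle_mono [OF 2 norm_triangle_mono [OF norm_triangle_mono [OF fb(2) 3] 4]] by simp
  also have "\<dots> \<le> 6 * A\<^sup>2" using A_pow by (simp add: power2_eq_square)
  finally have "(h / 2) * norm ((1 / \<epsilon>) *\<^sub>R J v0 + (Ep ?p + (B0 \<bullet> v0) *\<^sub>R \<beta> ?p + g ?p v0))
      \<le> h / 2 * (6 * A\<^sup>2)"
    using h by (intro mult_left_mono) auto
  with 1 v0(2) have "norm (u 0) \<le> A * \<epsilon> + h / 2 * (6 * A\<^sup>2)" by linarith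
  moreover have "A * \<epsilon> \<le> A\<^sup>2 * h"
    using A A_pow eps eps_small by (intro mult_mono) auto
  ultimately show "norm (u 0) \<le> 4 * A\<^sup>2 * h" by (simp add: algebra_simps)
  have B0B: "B0 \<bullet> cross3 v0 (B ?p) = B0 \<bullet> cross3 (P v0) (B1 ?p + \<epsilon> *\<^sub>R B2 ?p)"
    unfolding B0_cross3 [of v0]
    by (simp add: magnetic_field_def cross_add_right cross_mult_right inner_add_right dot_cross_self)
  have "norm (\<epsilon> *\<^sub>R B2 ?p) \<le> 1 * A"
    unfolding norm_scaleR using eps eps_small fb A by (intro mult_mono) auto
  with fb(1) have "norm (B1 ?p + \<epsilon> *\<^sub>R B2 ?p) \<le> A + 1 * A"
    by (rule norm_triangle_mono)
  moreover have "norm (P v0) \<le> A" using norm_P_le [of v0] v0 by simp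
  ultimately have "norm (cross3 (P v0) (B1 ?p + \<epsilon> *\<^sub>R B2 ?p)) \<le> A * (2 * A)"
    by (intro norm_cross3_le_mult) auto
  then have 5: "\<bar>B0 \<bullet> cross3 v0 (B ?p)\<bar> \<le> 2 * A * A"
    unfolding B0B by (intro order_trans [OF abs_B0_le]) simp
  have 6: "\<bar>B0 \<bullet> E ?p\<bar> \<le> 3 * A" using abs_B0_le [of "E ?p"] fb(7) by simp
  have "w 0 = B0 \<bullet> v0 + (h / 2) * (B0 \<bullet> cross3 v0 (B ?p) + B0 \<bullet> E ?p)"
    by (simp add: init inner_add_right)
  then have "\<bar>w 0\<bar> \<le> \<bar>B0 \<bullet> v0\<bar> + (h / 2) * \<bar>B0 \<bullet> cross3 v0 (B ?p) + B0 \<bullet> E ?p\<bar>"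
    using h by (simp add: abs_mult order_trans [OF abs_triangle_ineq])
  also have "\<dots> \<le> A + (h / 2) * (3 * A + 2 * A * A)"
    using m 5 6 h by (intro add_mono mult_left_mono) auto
  also have "\<dots> \<le> 2 * A"
    using h_small(5,6) A by (simp add: algebra_simps power2_eq_square)
  finally show "\<bar>w 0\<bar> \<le> 2 * A" .
qed

section \<open>The oscillating remainder of the perpendicular velocity\<close>

lemma square_le_rem_const: "9 * A\<^sup>2 \<le> rem_const A"
  unfolding rem_const_def using A_pow(1) [of 4] A_pow(3,4) by linarith

text \<open>Invariance of \<open>F\<close> along \<open>B0\<close> discards the parallel
  displacement, of order \<open>h\<close>. Only \<open>h *\<^sub>R u n\<close> counts, which is of
  order \<open>h\<^sup>2\<close> once \<open>u\<close> is \<open>O(h)\<close>.\<close>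

lemma near_step:
  assumes F: "F \<in> {B1, Ep}" and n: "ok n" and V: "norm (V n) \<le> 18 * A"
  shows "norm (F (X (Suc n)) - F (X n)) \<le> A * (h * norm (u n))"
proof -
  have PX: "P (X (Suc n)) - P (X n) = h *\<^sub>R u n"
    by (simp flip: P_diff P_scaleR add: V_diff)
  have "h * norm (u n) \<le> h * (18 * A)"
    using h V norm_P_le [of "V n"] by (intro mult_left_mono) auto
  also note small(2)
  finally have "norm (P (X (Suc n)) - P (X n)) \<le> \<delta>"
    using h by (simp add: PX)
  from near_lipschitz [OF F in_K_ok [OF n] this, of "X n"] show ?thesis
    using \<delta> h by (simp add: PX)
qed

lemma norm_\<beta>_diff_le: "norm (\<beta> a - \<beta> b) \<le> norm (B1 a - B1 b)"
  using norm_cross3_le [of B0 "B1 a - B1 b"]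
  by (simp add: \<beta>_def norm_B0 flip: Cross3.right_diff_distrib)

text \<open>The slowly varying part of the half-step velocity. Pairing \<open>w n\<close>, which lives at half steps,
  with \<open>\<beta>\<close> at the grid point makes two consecutive values add up to the guiding-centre
  drift with an error of second order in \<open>h\<close>.\<close>

definition uh :: "nat \<Rightarrow> real^3" where
  "uh n = \<epsilon> *\<^sub>R J (w n *\<^sub>R \<beta> (X n) + Ep (X n))"

definition r :: "nat \<Rightarrow> real^3" where "r n = u n - uh n"

lemma P_r [simp]: "P (r n) = r n"
  by (simp add: r_def uh_def P_diff P_scaleR)

lemma norm_uh_le:
  assumes "X n \<in> K" "\<bar>w n\<bar> \<le> 8 * A"
  shows "norm (uh n) \<le> \<epsilon> * (9 * A\<^sup>2)"
proof -
  have "norm (w n *\<^sub>R \<beta> (X n)) \<le> 8 * A * A"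
    unfolding norm_scaleR using assms field_bounds [OF assms(1)] A by (intro mult_mono) auto
  from norm_triangle_mono [OF this field_bounds(2) [OF assms(1)]]
  have "norm (w n *\<^sub>R \<beta> (X n) + Ep (X n)) \<le> 8 * A * A + A" .
  also have "\<dots> \<le> 9 * A\<^sup>2" using A_pow by (simp add: power2_eq_square)
  finally have "norm (J (w n *\<^sub>R \<beta> (X n) + Ep (X n))) \<le> 9 * A\<^sup>2"
    using norm_J_le order_trans by blast
  then show ?thesis using eps unfolding uh_def by simp
qed

lemma norm_u_le: "norm (u n) \<le> norm (r n) + norm (uh n)"
  using norm_triangle_ineq [of "r n" "uh n"] by (simp add: r_def)

text \<open>The defect of \<open>uh\<close> in the recurrence for \<open>u\<close>: the small force,
  the mismatch of slow forces at the two grid points, and the change of \<open>uh\<close>. The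
  coefficient is \<open>w n\<close> and no mean because the contributions of
  \<open>w (Suc n)\<close> cancel exactly.\<close>

definition \<rho> :: "nat \<Rightarrow> real^3" where
  "\<rho> n = g (X (Suc n)) (mid n)
     + (1 / 2) *\<^sub>R (w n *\<^sub>R (\<beta> (X (Suc n)) - \<beta> (X n)) + (Ep (X (Suc n)) - Ep (X n)))
     - (1 / h) *\<^sub>R (uh (Suc n) - uh n)"

lemma r_step: "r (Suc n) - r n = (h / (2 * \<epsilon>)) *\<^sub>R J (r (Suc n) + r n) + h *\<^sub>R \<rho> n"
proof -
  let ?b = "\<beta> (X (Suc n))" and ?bn = "\<beta> (X n)" and ?e = "Ep (X (Suc n))" and ?en = "Ep (X n)"
  have m: "B0 \<bullet> mid n = (w (Suc n) + w n) / 2"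
    by (simp add: mid_def inner_simps)
  \<comment> \<open>The choice of \<open>uh\<close> aims at this: rotated at rate
    \<open>1 / \<epsilon>\<close>, it balances the slow force.\<close>
  have Juh: "J (uh k) = - (\<epsilon> *\<^sub>R (w k *\<^sub>R \<beta> (X k) + Ep (X k)))" for k
    by (simp add: uh_def J_scaleR P_add P_scaleR scaleR_add_right scaleR_diff_right)
  have "(h / \<epsilon>) *\<^sub>R J (mid n) = (h / (2 * \<epsilon>)) *\<^sub>R J (u (Suc n) + u n)"
    by (simp add: mid_def J_add J_scaleR)
  also have "\<dots> = (h / (2 * \<epsilon>)) *\<^sub>R J (r (Suc n) + r n) + (h / (2 * \<epsilon>)) *\<^sub>R (J (uh (Suc n)) + J (uh n))"
    by (simp add: r_def J_add J_diff scaleR_add_right scaleR_diff_right)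
  also have "(h / (2 * \<epsilon>)) *\<^sub>R (J (uh (Suc n)) + J (uh n))
      = - ((h / 2) *\<^sub>R ((w (Suc n) *\<^sub>R ?b + ?e) + (w n *\<^sub>R ?bn + ?en)))"
    unfolding Juh using eps by (simp add: scaleR_add_right scaleR_diff_right)
  finally have mid: "(h / \<epsilon>) *\<^sub>R J (mid n) = (h / (2 * \<epsilon>)) *\<^sub>R J (r (Suc n) + r n)
      - (h / 2) *\<^sub>R ((w (Suc n) *\<^sub>R ?b + ?e) + (w n *\<^sub>R ?bn + ?en))" by simp
  have "r (Suc n) - r n = (u (Suc n) - u n) - (uh (Suc n) - uh n)"
    by (simp add: r_def)
  then have "r (Suc n) - r n = (h / (2 * \<epsilon>)) *\<^sub>R J (r (Suc n) + r n)
      + (h *\<^sub>R (?e + ((w (Suc n) + w n) / 2) *\<^sub>R ?b + g (X (Suc n)) (mid n))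
      - (h / 2) *\<^sub>R ((w (Suc n) *\<^sub>R ?b + ?e) + (w n *\<^sub>R ?bn + ?en)) - (uh (Suc n) - uh n))"
    unfolding u_step mid m by simp
  also have "h *\<^sub>R (?e + ((w (Suc n) + w n) / 2) *\<^sub>R ?b + g (X (Suc n)) (mid n))
      - (h / 2) *\<^sub>R ((w (Suc n) *\<^sub>R ?b + ?e) + (w n *\<^sub>R ?bn + ?en)) - (uh (Suc n) - uh n) = h *\<^sub>R \<rho> n"
  proof -
    have *: "h *\<^sub>R ?e = (h / 2) *\<^sub>R ?e + (h / 2) *\<^sub>R ?e"
      by (simp flip: scaleR_add_left)
    have "h * ((w (Suc n) + w n) / 2) = (h / 2) * w (Suc n) + (h / 2) * w n" by argo
    then show ?thesis
      unfolding \<rho>_def scaleR_add_right scaleR_diff_right scaleR_scaleR * using h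
      by (simp add: scaleR_add_left add_divide_distrib)
  qed
  finally show ?thesis .
qed

text \<open>The two bounds feed each other: \<rho> contains \<open>g\<close>, hence the
  perpendicular mean velocity, which \<open>r_step\<close> read backwards bounds with \<rho>
  multiplied by \<epsilon>. The same inversion gives the sum \<open>r (Suc n) + r n\<close>, unlike
  its terms, the gain \<open>\<epsilon> / h\<close>.\<close>

lemma norm_\<rho>_le:
  assumes n: "ok (Suc n)" and w: "\<bar>w n\<bar> \<le> 8 * A" "\<bar>w (Suc n)\<bar> \<le> 8 * A"
    and V: "norm (V n) \<le> 18 * A" and s: "norm (P (mid n)) \<le> 1"
  shows "norm (P (mid n)) \<le> \<epsilon> / h * (norm (r (Suc n)) + norm (r n)) + \<epsilon> * norm (\<rho> n) + \<epsilon> * (9 * A\<^sup>2)"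
      (is ?mid)
    and "norm (\<rho> n) \<le> rem_const A * (\<epsilon> + h * (norm (r (Suc n)) + norm (r n)))" (is ?rho)
proof -
  let ?p = "X (Suc n)" and ?q = "X n" and ?u = "norm (u n)"
  let ?R = "norm (r (Suc n)) + norm (r n)"
  have K: "?p \<in> K" "?q \<in> K" using in_K_ok n ok_SucD by auto
  note fb = field_bounds [OF K(1)]
  have dB: "norm (\<beta> ?p - \<beta> ?q) \<le> A * (h * ?u)"
    using near_step [of B1 n] norm_\<beta>_diff_le [of ?p ?q] ok_SucD [OF n] V by fastforce
  have dE: "norm (Ep ?p - Ep ?q) \<le> A * (h * ?u)"
    using near_step [of Ep n] ok_SucD [OF n] V by simp
  have wB: "norm (w n *\<^sub>R (\<beta> ?p - \<beta> ?q)) \<le> 8 * A * (A * (h * ?u))"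
    unfolding norm_scaleR using w dB A by (intro mult_mono) auto
  have AA: "A * (h * ?u) \<le> A * A * (h * ?u)"
    using A h by (intro mult_right_mono) auto
  have 1: "norm (w n *\<^sub>R (\<beta> ?p - \<beta> ?q) + (Ep ?p - Ep ?q)) \<le> 9 * A\<^sup>2 * (h * ?u)"
    using norm_triangle_mono [OF wB dE] AA by (simp add: power2_eq_square)
  have wW: "norm ((w (Suc n) - w n) *\<^sub>R \<beta> ?p) \<le> h * (4 * A) * A"
    unfolding norm_scaleR using w_step [OF K(1) s] fb A h by (intro mult_mono) auto
  have "uh (Suc n) - uh n
      = \<epsilon> *\<^sub>R J ((w (Suc n) - w n) *\<^sub>R \<beta> ?p + (w n *\<^sub>R (\<beta> ?p - \<beta> ?q) + (Ep ?p - Ep ?q)))"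
    unfolding uh_def scaleR_diff_right [symmetric] J_diff [symmetric]
    by (simp add: algebra_simps)
  then have "norm (uh (Suc n) - uh n)
      \<le> \<epsilon> * norm ((w (Suc n) - w n) *\<^sub>R \<beta> ?p + (w n *\<^sub>R (\<beta> ?p - \<beta> ?q) + (Ep ?p - Ep ?q)))"
    using eps norm_J_le by simp
  also have "\<dots> \<le> \<epsilon> * (h * (4 * A) * A + 9 * A\<^sup>2 * (h * ?u))"
    using eps norm_triangle_mono [OF wW 1] by (intro mult_left_mono) auto
  also have "\<dots> = h * (\<epsilon> * (4 * A\<^sup>2) + \<epsilon> * (9 * A\<^sup>2 * ?u))"
    by (simp add: power2_eq_square algebra_simps)
  finally have 2: "norm ((1 / h) *\<^sub>R (uh (Suc n) - uh n)) \<le> \<epsilon> * (4 * A\<^sup>2) + \<epsilon> * (9 * A\<^sup>2 * ?u)"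
    unfolding norm_scaleR using h by (simp add: pos_divide_le_eq mult.commute)
  have "\<epsilon> * (9 * A\<^sup>2 * ?u) \<le> h / 2 * (9 * A\<^sup>2 * ?u)"
    using eps_small by (intro mult_right_mono) auto
  then have 2: "norm ((1 / h) *\<^sub>R (uh (Suc n) - uh n)) \<le> \<epsilon> * (4 * A\<^sup>2) + h / 2 * (9 * A\<^sup>2 * ?u)"
    using 2 by linarith
  have "\<bar>B0 \<bullet> mid n\<bar> \<le> 8 * A"
    using w by (simp add: mid_def inner_simps)
  then have "\<epsilon> * A * (1 + \<bar>B0 \<bullet> mid n\<bar>) \<le> \<epsilon> * A * (9 * A)"
    using eps A by (intro mult_left_mono) auto
  then have 3: "norm (g ?p (mid n)) \<le> 2 * A * norm (P (mid n)) + \<epsilon> * (9 * A\<^sup>2)"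
    using norm_g_le [OF K(1), of "mid n"] by (simp add: power2_eq_square mult_ac)
  have "norm ((1 / 2) *\<^sub>R (w n *\<^sub>R (\<beta> ?p - \<beta> ?q) + (Ep ?p - Ep ?q))) \<le> 9 / 2 * A\<^sup>2 * (h * ?u)"
    using 1 by simp
  from norm_triangle_mono [OF 3 this]
  have "norm (\<rho> n) \<le> (2 * A * norm (P (mid n)) + \<epsilon> * (9 * A\<^sup>2) + 9 / 2 * A\<^sup>2 * (h * ?u))
      + (\<epsilon> * (4 * A\<^sup>2) + h / 2 * (9 * A\<^sup>2 * ?u))"
    unfolding \<rho>_def using 2 norm_triangle_ineq4 by (meson add_mono order_trans)
  then have \<rho>: "norm (\<rho> n) \<le> 2 * A * norm (P (mid n)) + 13 * A\<^sup>2 * \<epsilon> + 9 * A\<^sup>2 * h * ?u"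
    by (simp add: algebra_simps)
  have uh: "norm (uh n) \<le> \<epsilon> * (9 * A\<^sup>2)" "norm (uh (Suc n)) \<le> \<epsilon> * (9 * A\<^sup>2)"
    using K w by (auto intro: norm_uh_le)
  have "norm (r (Suc n) + r n) = norm (J (r (Suc n) + r n))"
    by (simp add: P_add)
  also have "J (r (Suc n) + r n) = (2 * \<epsilon> / h) *\<^sub>R (r (Suc n) - r n - h *\<^sub>R \<rho> n)"
    unfolding r_step using eps h by simp
  also have "norm \<dots> \<le> 2 * \<epsilon> / h * (?R + h * norm (\<rho> n))"
  proof -
    have "norm (r (Suc n) - r n - h *\<^sub>R \<rho> n) \<le> ?R + h * norm (\<rho> n)"
      using h by (intro order_trans [OF norm_triangle_ineq4] add_mono norm_triangle_ineq4) auto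
    then show ?thesis unfolding norm_scaleR using eps h by (intro mult_mono) auto
  qed
  finally have R: "norm (r (Suc n) + r n) \<le> 2 * (\<epsilon> / h * ?R + \<epsilon> * norm (\<rho> n))"
    using h by (simp add: field_simps)
  have "P (mid n) = (1 / 2) *\<^sub>R ((r (Suc n) + r n) + (uh (Suc n) + uh n))"
    by (simp add: mid_def P_scaleR P_add r_def)
  then have "norm (P (mid n)) \<le> (1 / 2) * (norm (r (Suc n) + r n) + norm (uh (Suc n) + uh n))"
    using norm_triangle_ineq by simp
  moreover have "m \<le> z + e" if "m \<le> (1 / 2) * (a + b)" "a \<le> 2 * z" "b \<le> b' + b''" "b' \<le> e" "b'' \<le> e"
    for m a b b' b'' z e :: real using that by simp
  ultimately show mid: ?mid
    using R norm_triangle_ineq uh(2,1) by blast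
  have "\<epsilon> / h * ?R \<le> h * ?R"
    using eps_small by (intro mult_right_mono) auto
  with mid have "norm (P (mid n)) \<le> h * ?R + \<epsilon> * norm (\<rho> n) + \<epsilon> * (9 * A\<^sup>2)" by linarith
  from mult_left_mono [OF this, of "2 * A"] A
  have s': "2 * A * norm (P (mid n)) \<le> 2 * A * h * ?R + 2 * (\<epsilon> * A) * norm (\<rho> n) + 18 * A ^ 3 * \<epsilon>"
    by (simp add: algebra_simps power2_eq_square power3_eq_cube)
  have "\<epsilon> * A \<le> h * A" using eps_small A by (intro mult_right_mono) auto
  then have "\<epsilon> * A \<le> 1 / 4" using h_small by simp
  \<comment> \<open>The feedback is absorbed into the left-hand side, which doubles all other terms
    below.\<close>
  then have "2 * (\<epsilon> * A) * norm (\<rho> n) \<le> 1 / 2 * norm (\<rho> n)"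
    by (intro mult_right_mono) auto
  moreover have "9 * A\<^sup>2 * h * ?u \<le> 9 * A\<^sup>2 * h * (norm (r n) + \<epsilon> * (9 * A\<^sup>2))"
    using h norm_u_le [of n] uh by (intro mult_left_mono) auto
  ultimately have "norm (\<rho> n) \<le> 2 * (2 * A * (h * ?R)) + 2 * (18 * A ^ 3 * \<epsilon>) + 2 * (13 * A\<^sup>2 * \<epsilon>)
     + 2 * (9 * A\<^sup>2 * (h * norm (r n))) + 2 * (h * (81 * A ^ 4 * \<epsilon>))"
    using \<rho> s' by (simp add: algebra_simps power2_eq_square power4_eq_xxxx)
  also have "\<dots> \<le> 2 * (2 * A ^ 4 * (h * ?R)) + 2 * (18 * A ^ 4 * \<epsilon>) + 2 * (13 * A ^ 4 * \<epsilon>)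
     + 2 * (9 * A ^ 4 * (h * ?R)) + 2 * (1 * (81 * A ^ 4 * \<epsilon>))"
    using A_pow h eps h_small A
    by (intro add_mono mult_left_mono mult_right_mono mult_mono) auto
  also have "\<dots> \<le> rem_const A * (\<epsilon> + h * ?R)"
    unfolding rem_const_def using h eps A by (simp add: algebra_simps)
  finally show ?rho .
qed

text \<open>Each step grows by \<open>1 + O(\<epsilon> * h)\<close> and adds
  \<open>O(\<epsilon>\<^sup>2)\<close>. Over at most \<open>A / (\<epsilon> * h)\<close> steps the
  growth stays bounded and the additions sum to \<open>O(\<epsilon> / h)\<close>, within
  \<open>O(h)\<close>, the bound for \<open>r 0\<close>.\<close>

lemma r_bound:
  assumes n: "ok n" and w: "\<And>k. k \<le> n \<Longrightarrow> \<bar>w k\<bar> \<le> 8 * A"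
    and V: "\<And>k. k < n \<Longrightarrow> norm (V k) \<le> 18 * A" and s: "\<And>k. k < n \<Longrightarrow> norm (P (mid k)) \<le> 1"
  shows "norm (r n) \<le> exp (8 * rem_const A * A) * (5 * rem_const A * A * h)" "norm (u n) \<le> vel_const A * h"
proof -
  have D0: "0 \<le> rem_const A" using const_bounds(1) by simp
  have "norm (r (Suc k)) \<le> (1 + 8 * rem_const A * \<epsilon> * h) * norm (r k) + 4 * rem_const A * \<epsilon>\<^sup>2" if "k < n" for k
  proof -
    let ?R = "norm (r (Suc k)) + norm (r k)"
    have ok: "ok (Suc k)" using n that by (meson Suc_leI ok_mono)
    have "norm (r (Suc k)) \<le> norm (r k) + norm (h *\<^sub>R \<rho> k) / (h / (2 * \<epsilon>))"
      using h eps by (intro norm_cayley_step [OF r_step]) auto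
    also have "\<dots> = norm (r k) + 2 * \<epsilon> * norm (\<rho> k)"
      using h eps by (simp add: field_simps)
    also have "2 * \<epsilon> * norm (\<rho> k) \<le> 2 * \<epsilon> * (rem_const A * (\<epsilon> + h * ?R))"
      using norm_\<rho>_le(2) [OF ok] w V s that eps by (intro mult_left_mono) auto
    finally have 1: "norm (r (Suc k)) \<le> norm (r k) + 2 * rem_const A * \<epsilon> * h * ?R + 2 * rem_const A * \<epsilon>\<^sup>2"
      by (simp add: algebra_simps power2_eq_square)
    have "2 * (h * rem_const A) * \<epsilon> \<le> 2 * (1 / 6) * 1"
      using h_small(3) eps_small(4) eps h D0 by (intro mult_mono) auto
    then have "norm (r (Suc k)) \<le> (1 + 4 * (2 * rem_const A * \<epsilon> * h)) * norm (r k) + 2 * (2 * rem_const A * \<epsilon>\<^sup>2)"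
      using eps h D0 by (intro perturbed_step_le [OF 1]) (auto simp: algebra_simps)
    then show ?thesis by (simp add: algebra_simps)
  qed
  then have "norm (r n) \<le> exp (real n * (8 * rem_const A * \<epsilon> * h)) * (norm (r 0) + real n * (4 * rem_const A * \<epsilon>\<^sup>2))"
    using D0 h eps by (intro discrete_gronwall) auto
  also have "\<dots> \<le> exp (8 * rem_const A * A) * (rem_const A * A * h + 4 * rem_const A * A * h)"
  proof (rule mult_mono)
    have T: "\<epsilon> * (real n * h) \<le> A" using n A by (simp add: ok_def)
    then have "8 * rem_const A * (\<epsilon> * (real n * h)) \<le> 8 * rem_const A * A"
      using D0 by (intro mult_left_mono) auto
    then show "exp (real n * (8 * rem_const A * \<epsilon> * h)) \<le> exp (8 * rem_const A * A)"
      by (simp add: mult_ac)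
    have "real n * (4 * rem_const A * \<epsilon>\<^sup>2) = 4 * rem_const A * (\<epsilon> * (real n * h)) * (\<epsilon> / h)"
      using h by (simp add: power2_eq_square)
    also have "\<dots> \<le> 4 * rem_const A * A * h"
      using T D0 A eps h eps_small by (intro mult_mono mult_left_mono) auto
    finally have 1: "real n * (4 * rem_const A * \<epsilon>\<^sup>2) \<le> 4 * rem_const A * A * h" .
    have "norm (uh 0) \<le> \<epsilon> * (9 * A\<^sup>2)"
      using norm_uh_le [of 0] w in_K_ok ok_0 by simp
    also have "\<dots> \<le> h * (9 * A\<^sup>2)"
      using eps_small by (intro mult_right_mono) auto
    finally have "norm (r 0) \<le> 4 * A\<^sup>2 * h + h * (9 * A\<^sup>2)"
      unfolding r_def using V0_bounds(1) norm_triangle_ineq4 [of "u 0" "uh 0"] by linarith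
    also have "\<dots> = 13 * A\<^sup>2 * h" by simp
    also have "\<dots> \<le> rem_const A * 1 * h"
      unfolding rem_const_def using h A_pow(1) [of 4] A_pow(3,4) by (intro mult_right_mono) linarith+
    also have "\<dots> \<le> rem_const A * A * h"
      using D0 A h by (intro mult_mono) auto
    finally have "norm (r 0) \<le> rem_const A * A * h" .
    with 1 show "norm (r 0) + real n * (4 * rem_const A * \<epsilon>\<^sup>2) \<le> rem_const A * A * h + 4 * rem_const A * A * h"
      by linarith
  qed (use D0 h A eps in auto)
  also have "\<dots> = exp (8 * rem_const A * A) * (5 * rem_const A * A * h)" by (simp add: algebra_simps)
  finally show r: "norm (r n) \<le> exp (8 * rem_const A * A) * (5 * rem_const A * A * h)" .
  have "norm (uh n) \<le> \<epsilon> * (9 * A\<^sup>2)"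
    using norm_uh_le [of n] w in_K_ok n by simp
  also have "\<dots> \<le> h * (1 * (rem_const A * 1))"
    using mult_mono [OF eps_small(6) square_le_rem_const] h by simp
  also have "\<dots> \<le> h * (exp (8 * rem_const A * A) * (rem_const A * A))"
    using h D0 A by (intro mult_left_mono mult_mono) auto
  finally have "norm (u n) \<le> exp (8 * rem_const A * A) * (5 * rem_const A * A * h) + h * (exp (8 * rem_const A * A) * (rem_const A * A))"
    using r norm_u_le [of n] by linarith
  then show "norm (u n) \<le> vel_const A * h" by (simp add: vel_const_def algebra_simps)
qed

text \<open>The induction closes on \<open>9 * A\<close>. One energy step keeps \<open>V n\<close>
  below \<open>18 * A\<close>, which makes the perpendicular mean velocities small; then
  \<open>w\<close> is at most \<open>8 * A\<close>, \<open>r_bound\<close> applies, and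
  \<open>vel_const A * h \<le> 1\<close> brings the sum back to \<open>9 * A\<close>.\<close>

lemma stability:
  assumes "ok n"
  shows "norm (V n) \<le> 9 * A \<and> \<bar>w n\<bar> \<le> 8 * A \<and> norm (u n) \<le> vel_const A * h \<and>
    norm (r n) \<le> vel_const A * h \<and> (\<forall>k<n. norm (P (mid k)) \<le> 1)"
  using assms
proof (induction n rule: less_induct)
  case (less n)
  have IH: "norm (V k) \<le> 9 * A" "\<bar>w k\<bar> \<le> 8 * A" if "k < n" for k
    using less that ok_mono less_imp_le by blast+
  have V: "norm (V k) \<le> 18 * A" if k: "k \<le> n" for k
  proof (cases k)
    case 0
    have "4 * A\<^sup>2 * h \<le> 1" using h_small by (simp add: mult_ac)
    then have "norm (V 0) \<le> 18 * A" using norm_le_split [of "V 0"] V0_bounds A by linarith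
    then show ?thesis by (simp add: 0)
  next
    case (Suc j)
    have "X (Suc j) \<in> K" using k Suc less in_K_ok ok_mono by blast
    from energy_step [OF this] IH(1) [of j] k Suc
    have "norm (V k) \<le> 9 * A + h * (3 * A)" by simp
    then show ?thesis using h_small A by linarith
  qed
  have s: "norm (P (mid k)) \<le> 1" if "k < n" for k
    using mid_small [of k] V [of k] V [of "Suc k"] that in_K_ok ok_mono [OF less(2)] by simp
  \<comment> \<open>Positions in \<open>K\<close> are bounded by \<open>A\<close> and the parallel
    acceleration by \<open>4 * A\<close>; no sum over the long time occurs.\<close>
  have wn: "\<bar>w n\<bar> \<le> max (\<bar>w 0\<bar> + 4 * A) (4 * A + 4 * A)"
  proof (rule discrete_landau)
    show "B0 \<bullet> X (Suc k) - B0 \<bullet> X k = h * w k" for k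
      by (simp flip: inner_diff_right add: V_diff)
    show "\<bar>B0 \<bullet> X k\<bar> \<le> A" if "k \<le> n" for k
      using order_trans [OF abs_B0_le K_le] in_K_ok ok_mono [OF less(2)] that by simp
    show "\<bar>w (Suc k) - w k\<bar> \<le> h * (4 * A)" if "k < n" for k
      using that s w_step in_K_ok ok_mono [OF less(2)] by simp
  qed (use h h_small A in auto)
  then have wn: "\<bar>w n\<bar> \<le> 8 * A" using V0_bounds(2) A by simp
  have w: "\<bar>w k\<bar> \<le> 8 * A" if "k \<le> n" for k
    using that wn IH by (cases "k = n") auto
  note rb = r_bound [OF less(2) w V [OF less_imp_le] s]
  have "norm (V n) \<le> 9 * A"
    using norm_le_split [of "V n"] rb(2) wn h_small(2) A by (simp add: mult.commute)
  moreover have "exp (8 * rem_const A * A) * (5 * rem_const A * A * h) \<le> vel_const A * h"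
    using h A const_bounds(1) by (simp add: vel_const_def mult_ac)
  ultimately show ?case using rb wn s by auto
qed

text \<open>\<open>r\<close> is merely \<open>O(h)\<close>, but its two-term sums gain
  \<open>\<epsilon> / h\<close>; the other contributions carry \<epsilon> already.\<close>

lemma mid_le:
  assumes n: "ok (Suc n)"
  shows "norm (P (mid n)) \<le> \<epsilon> * drift_const A"
proof -
  note st = stability [OF n] and st0 = stability [OF ok_SucD [OF n]]
  let ?R = "norm (r (Suc n)) + norm (r n)"
  have D0: "0 \<le> rem_const A" using const_bounds(1) by simp
  have V: "norm (V n) \<le> 18 * A" using st0 A by auto
  have R: "?R \<le> 2 * vel_const A * h" using st st0 by simp
  have s: "norm (P (mid n)) \<le> 1" using st by simp
  note b = norm_\<rho>_le [OF n _ _ V s]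
  have "h * ?R \<le> (1 / 2) * (2 * (vel_const A * h))"
    using R h h_small by (intro mult_mono) auto
  then have "\<epsilon> + h * ?R \<le> 2" using h_small(2) eps_small(4) by (simp add: mult.commute)
  then have "rem_const A * (\<epsilon> + h * ?R) \<le> rem_const A * 2" using D0 by (intro mult_left_mono) auto
  with b(2) st st0 have "norm (\<rho> n) \<le> 2 * rem_const A" by simp
  then have 1: "\<epsilon> * norm (\<rho> n) \<le> \<epsilon> * (2 * vel_const A)"
    using eps const_bounds by (intro mult_left_mono) auto
  have 2: "\<epsilon> / h * ?R \<le> \<epsilon> / h * (2 * vel_const A * h)"
    using R eps h by (intro mult_left_mono) auto
  have 3: "\<epsilon> * (9 * A\<^sup>2) \<le> \<epsilon> * vel_const A"
    using square_le_rem_const const_bounds eps by (intro mult_left_mono) auto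
  have "norm (P (mid n)) \<le> \<epsilon> * (5 * vel_const A)"
    using b(1) st st0 1 2 3 h by (simp add: mult_ac)
  also have "\<dots> \<le> \<epsilon> * drift_const A"
  proof -
    have "5 * vel_const A \<le> 6 * rem_const A * vel_const A" using const_bounds by (intro mult_right_mono) auto
    then show ?thesis unfolding const_bounds(4) using eps by (intro mult_left_mono) auto
  qed
  finally show ?thesis .
qed

section \<open>Comparison with the slow equation\<close>

text \<open>A discrete product of parallel position and \<beta> with crossed indices. Its increment
  is the drift term at \<open>X (Suc n)\<close> plus a difference of \<beta> over two steps, where
  the oscillation cancels and the displacement is \<open>O(\<epsilon> * h)\<close>. A one-step
  difference would be \<open>O(h\<^sup>2)\<close> and sum to an error of order
  \<open>h\<close>.\<close>

definition G :: "nat \<Rightarrow> real^3" where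
  "G n = (1 / 2) *\<^sub>R ((B0 \<bullet> X (Suc n)) *\<^sub>R \<beta> (X n) + (B0 \<bullet> X n) *\<^sub>R \<beta> (X (Suc n)))"

text \<open>A position close to \<open>P (X n)\<close> whose increments are those of the Euler method for the slow
  equation up to \<open>\<epsilon>\<^sup>2 h\<close>: the mean removes the oscillation, \<open>G\<close> sums up the drift proportional to
  the parallel velocity, and the last term sums up the acceleration.\<close>

definition q :: "nat \<Rightarrow> real^3" where
  "q n = (1 / 2) *\<^sub>R (P (X (Suc n)) + P (X n)) - \<epsilon> *\<^sub>R J (G n) + \<epsilon> *\<^sub>R J (u n)"

lemma PX_diff: "P (X (Suc n)) - P (X n) = h *\<^sub>R u n"
  by (simp flip: P_diff P_scaleR add: V_diff)

text \<open>Needed at the last admissible index, where \<open>X (Suc n)\<close> may lie outside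
  \<open>K\<close>.\<close>

lemma near_Suc:
  assumes "ok n"
  shows "norm (P (X (Suc n)) - P (X n)) \<le> \<delta>" "norm (P (X (Suc n)) - P (X n)) \<le> vel_const A * h\<^sup>2"
proof -
  have "h * norm (u n) \<le> h * (vel_const A * h)"
    using stability [OF assms] h by (intro mult_left_mono) auto
  then show *: "norm (P (X (Suc n)) - P (X n)) \<le> vel_const A * h\<^sup>2"
    using h by (simp add: PX_diff power2_eq_square mult_ac)
  have "vel_const A * h\<^sup>2 = h * vel_const A * h" by (simp add: power2_eq_square)
  also have "\<dots> \<le> 1 * h" using h_small h by (intro mult_right_mono) auto
  also have "\<dots> \<le> h * (18 * A)" using h A by simp
  finally show "norm (P (X (Suc n)) - P (X n)) \<le> \<delta>" using * small by linarith
qed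

text \<open>Applying \<open>\<epsilon> *\<^sub>R J\<close> to \<open>u_step\<close> expresses
  \<open>h *\<^sub>R P (mid n)\<close>, half the two-step displacement, through the forces and a
  telescoping term, the one added in \<open>q\<close>. The increment of \<open>G\<close> cancels the
  drift with \<beta>.\<close>

lemma q_step:
  "q (Suc n) - q n = (\<epsilon> * h) *\<^sub>R J (Ep (X (Suc n))) + ((\<epsilon> * h) *\<^sub>R J (g (X (Suc n)) (mid n))
     - (\<epsilon> * (B0 \<bullet> X (Suc n)) / 2) *\<^sub>R J (\<beta> (X (Suc (Suc n))) - \<beta> (X n)))"
proof -
  let ?b = "\<beta> (X (Suc n))" and ?m = "B0 \<bullet> mid n" and ?f = "Ep (X (Suc n))" and ?g = "g (X (Suc n)) (mid n)"
  let ?\<xi> = "\<lambda>n. B0 \<bullet> X n"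
  have PXX: "P (X (Suc (Suc n))) - P (X n) = (2 * h) *\<^sub>R P (mid n)"
    using PX_diff [of "Suc n"] PX_diff [of n] by (simp add: mid_def P_scaleR P_add algebra_simps)
  have \<xi>: "?\<xi> (Suc (Suc n)) = ?\<xi> n + 2 * h * ?m"
    using arg_cong [OF V_diff [of "Suc n"], of "\<lambda>v. B0 \<bullet> v"] arg_cong [OF V_diff [of n], of "\<lambda>v. B0 \<bullet> v"]
    by (simp add: mid_def inner_simps algebra_simps)
  have "J (u (Suc n) - u n) = - ((h / \<epsilon>) *\<^sub>R P (mid n)) + h *\<^sub>R J (?f + ?m *\<^sub>R ?b + ?g)"
    unfolding u_step J_add [of "(h / \<epsilon>) *\<^sub>R J (mid n)"] J_scaleR by simp
  then have "\<epsilon> *\<^sub>R J (u (Suc n) - u n) = \<epsilon> *\<^sub>R (- ((h / \<epsilon>) *\<^sub>R P (mid n)) + h *\<^sub>R J (?f + ?m *\<^sub>R ?b + ?g))"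
    by simp
  then have mid: "h *\<^sub>R P (mid n) + \<epsilon> *\<^sub>R J (u (Suc n) - u n) = (\<epsilon> * h) *\<^sub>R J (?f + ?m *\<^sub>R ?b + ?g)"
    using eps by (simp add: scaleR_add_right scaleR_diff_right)
  have G: "G (Suc n) - G n = (h * ?m) *\<^sub>R ?b + (?\<xi> (Suc n) / 2) *\<^sub>R (\<beta> (X (Suc (Suc n))) - \<beta> (X n))"
    unfolding G_def \<xi> by (simp add: algebra_simps add_divide_distrib)
  have "q (Suc n) - q n = (1 / 2) *\<^sub>R (P (X (Suc (Suc n))) - P (X n))
      - \<epsilon> *\<^sub>R J (G (Suc n) - G n) + \<epsilon> *\<^sub>R J (u (Suc n) - u n)"
    unfolding q_def J_diff by (simp add: algebra_simps)
  also have "\<dots> = (\<epsilon> * h) *\<^sub>R J (?f + ?m *\<^sub>R ?b + ?g) - \<epsilon> *\<^sub>R J (G (Suc n) - G n)"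
    unfolding PXX mid [symmetric] by simp
  finally show ?thesis unfolding G J_add J_scaleR scaleR_add_right by simp
qed

lemma abs_mid_le:
  assumes "ok (Suc n)"
  shows "\<bar>B0 \<bullet> mid n\<bar> \<le> 8 * A"
proof -
  have "\<bar>w (Suc n)\<bar> \<le> 8 * A" "\<bar>w n\<bar> \<le> 8 * A"
    using stability [OF assms] stability [OF ok_SucD [OF assms]] by auto
  then show ?thesis by (simp add: mid_def inner_simps)
qed

lemma drift_const_bounds: "9 * A\<^sup>2 \<le> 9 * A\<^sup>2 * drift_const A" "2 * A * drift_const A \<le> 2 * A\<^sup>2 * drift_const A" "0 \<le> drift_const A"
proof -
  show 0: "0 \<le> drift_const A" using const_bounds by simp
  have "9 * A\<^sup>2 * 1 \<le> 9 * A\<^sup>2 * drift_const A" using const_bounds(8) by (intro mult_left_mono) auto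
  then show "9 * A\<^sup>2 \<le> 9 * A\<^sup>2 * drift_const A" by simp
  show "2 * A * drift_const A \<le> 2 * A\<^sup>2 * drift_const A" using A_pow 0 by (intro mult_right_mono) auto
qed

text \<open>By \<open>mid_le\<close>, \<open>g\<close> is \<open>O(\<epsilon>)\<close> and the
  two-step change of \<beta> is \<open>O(\<epsilon> * h)\<close>; the prefactors supply the second
  \<epsilon>. Over the whole time these defects sum to \<open>O(\<epsilon>)\<close>.\<close>

lemma q_step_error:
  assumes n: "ok (Suc n)"
  shows "norm (q (Suc n) - q n - (\<epsilon> * h) *\<^sub>R J (Ep (X (Suc n)))) \<le> \<epsilon>\<^sup>2 * h * (12 * A\<^sup>2 * drift_const A)"
proof -
  let ?p = "X (Suc n)"
  have K: "?p \<in> K" by (rule in_K_ok [OF n])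
  have "\<epsilon> * A * (1 + \<bar>B0 \<bullet> mid n\<bar>) \<le> \<epsilon> * A * (9 * A)"
    using eps A abs_mid_le [OF n] by (intro mult_left_mono) auto
  moreover have "2 * A * norm (P (mid n)) \<le> 2 * A * (\<epsilon> * drift_const A)"
    using mid_le [OF n] A by (intro mult_left_mono) auto
  ultimately have "norm (g ?p (mid n)) \<le> \<epsilon> * (2 * A * drift_const A + 9 * A\<^sup>2)"
    using norm_g_le [OF K, of "mid n"] by (simp add: algebra_simps power2_eq_square)
  also have "\<dots> \<le> \<epsilon> * (11 * A\<^sup>2 * drift_const A)"
    using eps drift_const_bounds by (intro mult_left_mono) auto
  finally have "norm (J (g ?p (mid n))) \<le> \<epsilon> * (11 * A\<^sup>2 * drift_const A)"
    using norm_J_le order_trans by blast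
  then have "(\<epsilon> * h) * norm (J (g ?p (mid n))) \<le> (\<epsilon> * h) * (\<epsilon> * (11 * A\<^sup>2 * drift_const A))"
    using eps h by (intro mult_left_mono) auto
  then have 1: "norm ((\<epsilon> * h) *\<^sub>R J (g ?p (mid n))) \<le> \<epsilon>\<^sup>2 * h * (11 * A\<^sup>2 * drift_const A)"
    using eps h by (simp add: power2_eq_square mult_ac)
  have "P (X (Suc (Suc n))) - P (X n) = (2 * h) *\<^sub>R P (mid n)"
    using PX_diff [of "Suc n"] PX_diff [of n] by (simp add: mid_def P_scaleR P_add algebra_simps)
  then have PXX: "norm (P (X (Suc (Suc n))) - P (X n)) \<le> 2 * h * (\<epsilon> * drift_const A)"
    using mid_le [OF n] h by simp
  have "norm (B1 (X (Suc (Suc n))) - B1 (X n)) \<le> A * norm (P (X (Suc (Suc n))) - P (X n))"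
    using near_Suc(1) [OF n] near_Suc(1) [OF ok_SucD [OF n]]
    by (intro near_lipschitz [OF _ K]) (auto simp: norm_minus_commute)
  also have "\<dots> \<le> A * (2 * h * (\<epsilon> * drift_const A))"
    using PXX A by (intro mult_left_mono) auto
  finally have "norm (J (\<beta> (X (Suc (Suc n))) - \<beta> (X n))) \<le> A * (2 * h * (\<epsilon> * drift_const A))"
    by (rule order_trans [OF order_trans [OF norm_J_le norm_\<beta>_diff_le]])
  moreover have "\<bar>B0 \<bullet> ?p\<bar> \<le> A" using abs_B0_le [of ?p] K_le [OF K] by simp
  then have "\<bar>\<epsilon> * (B0 \<bullet> ?p) / 2\<bar> \<le> \<epsilon> * A / 2"
    using eps by (simp add: abs_mult)
  ultimately have 2: "norm ((\<epsilon> * (B0 \<bullet> ?p) / 2) *\<^sub>R J (\<beta> (X (Suc (Suc n))) - \<beta> (X n)))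
      \<le> (\<epsilon> * A / 2) * (A * (2 * h * (\<epsilon> * drift_const A)))"
    unfolding norm_scaleR using eps A by (intro mult_mono) auto
  also have "\<dots> = \<epsilon>\<^sup>2 * h * (A\<^sup>2 * drift_const A)"
    by (simp add: power2_eq_square)
  finally show ?thesis
    unfolding q_step add_diff_cancel_left' using 1
    by (intro order_trans [OF norm_triangle_ineq4]) (simp add: algebra_simps)
qed

lemma norm_q_diff_le:
  assumes n: "ok n"
  shows "norm (q n - P (X n)) \<le> 3 * vel_const A * h\<^sup>2"
proof -
  note st = stability [OF n]
  have K: "X n \<in> K" by (rule in_K_ok [OF n])
  have A2: "2 * A\<^sup>2 \<le> vel_const A" using square_le_rem_const const_bounds(3) A_pow(1) [of 2] by linarith
  \<comment> \<open>As \<open>X (Suc n)\<close> need not lie in \<open>K\<close>, its field and its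
    parallel coordinate are bounded through closeness to \<open>X n\<close>.\<close>
  have "norm (B1 (X (Suc n))) \<le> A"
    using near_bound [of B1, OF _ K near_Suc(1) [OF n]] by simp
  then have b: "norm (\<beta> (X (Suc n))) \<le> A"
    using norm_cross3_le_mult [of B0 1] by (simp add: \<beta>_def norm_B0)
  have \<xi>: "\<bar>B0 \<bullet> X n\<bar> \<le> A" using abs_B0_le [of "X n"] K_le [OF K] by simp
  have "B0 \<bullet> X (Suc n) = B0 \<bullet> X n + h * w n"
    using arg_cong [OF V_diff [of n], of "\<lambda>v. B0 \<bullet> v"] by (simp add: inner_simps)
  moreover have "\<bar>h * w n\<bar> \<le> h * (8 * A)"
    unfolding abs_mult using st h by (intro mult_mono) auto
  ultimately have \<xi>': "\<bar>B0 \<bullet> X (Suc n)\<bar> \<le> 2 * A"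
    using \<xi> h_small(6) A by linarith
  have 1: "norm ((B0 \<bullet> X (Suc n)) *\<^sub>R \<beta> (X n)) \<le> 2 * A * A"
    unfolding norm_scaleR using \<xi>' field_bounds(6) [OF K] A by (intro mult_mono) auto
  have 2: "norm ((B0 \<bullet> X n) *\<^sub>R \<beta> (X (Suc n))) \<le> A * A"
    unfolding norm_scaleR using \<xi> b A by (intro mult_mono) auto
  have "norm (G n) \<le> (1 / 2) * (2 * A * A + A * A)"
    using norm_triangle_mono [OF 1 2] by (simp add: G_def)
  also have "\<dots> = 3 / 2 * A\<^sup>2" by (simp add: power2_eq_square)
  also have "\<dots> \<le> 2 * A\<^sup>2" by (intro mult_right_mono) auto
  finally have "norm (G n) \<le> 2 * A\<^sup>2" .
  then have "norm (J (G n)) \<le> vel_const A" using norm_J_le [of "G n"] A2 by linarith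
  then have 3: "norm (\<epsilon> *\<^sub>R J (G n)) \<le> h\<^sup>2 * vel_const A"
    unfolding norm_scaleR using eps by (intro mult_mono) auto
  have "norm (J (u n)) \<le> vel_const A"
    using st h_small(2,4) h norm_J_le [of "u n"] const_bounds(5) by (simp add: mult.commute)
  then have 4: "norm (\<epsilon> *\<^sub>R J (u n)) \<le> h\<^sup>2 * vel_const A"
    unfolding norm_scaleR using eps by (intro mult_mono) auto
  have "q n - P (X n) = (1 / 2) *\<^sub>R (P (X (Suc n)) - P (X n)) - \<epsilon> *\<^sub>R J (G n) + \<epsilon> *\<^sub>R J (u n)"
    using scaleR_half_double [of "P (X n)"] by (simp add: q_def scaleR_add_right scaleR_diff_right)
  also have "norm \<dots> \<le> norm ((1 / 2) *\<^sub>R (P (X (Suc n)) - P (X n))) + h\<^sup>2 * vel_const A + h\<^sup>2 * vel_const A"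
    using 3 4 by (intro norm_triangle_mono order_trans [OF norm_triangle_ineq4]) auto
  also have "\<dots> \<le> 3 * vel_const A * h\<^sup>2"
  proof -
    have "0 \<le> vel_const A * h\<^sup>2" using const_bounds by simp
    moreover have "norm ((1 / 2) *\<^sub>R (P (X (Suc n)) - P (X n))) = norm (P (X (Suc n)) - P (X n)) / 2"
      by simp
    moreover have "3 * vel_const A * h\<^sup>2 = vel_const A * h\<^sup>2 + h\<^sup>2 * vel_const A + h\<^sup>2 * vel_const A" by simp
    ultimately show ?thesis
      using near_Suc(2) [OF n] by linarith
  qed
  finally show ?thesis .
qed

end

text \<open>\<Psi> is \<open>Ep\<close> itself when a slow solution is given, and a globally
  Lipschitz modification when one is constructed. The slack in \<open>y0\<close> covers both
  starting positions.\<close>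

locale boris_tracking = boris_run +
  fixes y :: "real \<Rightarrow> real^3" and \<Psi> :: "real^3 \<Rightarrow> real^3"
  assumes small': "error_const A * h \<le> \<delta> / 2"
    and \<Psi>: "\<And>k p. k \<in> K \<Longrightarrow> norm (p - P_perp B0 k) \<le> \<delta> \<Longrightarrow> \<Psi> p = Ep p"
    and y0: "norm (P_perp B0 (X 0) - y 0) \<le> A * \<epsilon>"
    and y: "\<And>t. t \<in> {0..c / \<epsilon>} \<Longrightarrow>
      (y has_vector_derivative \<epsilon> *\<^sub>R cross3 (\<Psi> (y t)) B0) (at t within {0..c / \<epsilon>})"
begin

lemma near_P: "norm (p - P k) \<le> d \<Longrightarrow> norm (P p - P k) \<le> d"
  using norm_P_le [of "p - P k"] by (simp add: P_diff)

text \<open>In time at most \<open>h\<close> the solution moves less than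
  \<open>\<delta> / 2\<close>, so it stays where \<Psi> is \<open>Ep\<close> and the Lipschitz bound
  holds; the second claim is the local error of the Euler method. General \<open>a\<close> and
  \<open>b\<close> admit the incomplete step in \<open>y_near_K\<close>.\<close>

lemma y_step:
  assumes n: "ok n" and ab: "0 \<le> a" "a \<le> b" "b \<le> c / \<epsilon>" "b - a \<le> h"
    and a: "norm (P (X n) - y a) \<le> \<delta> / 2"
  shows "norm (y b - P (X n)) \<le> \<delta>"
    and "norm (y b - y a - ((b - a) * \<epsilon>) *\<^sub>R J (Ep (y a))) \<le> \<epsilon>\<^sup>2 * A\<^sup>2 * (b - a)\<^sup>2"
proof -
  have K: "X n \<in> K" by (rule in_K_ok [OF n])
  have der: "(y has_vector_derivative \<epsilon> *\<^sub>R J (\<Psi> (y t))) (at t within {a..b})" if "t \<in> {a..b}" for t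
    using ab that by (intro has_vector_derivative_within_subset [OF y]) auto
  have near: "norm (y t - P (X n)) \<le> \<delta>" if "norm (y t - y a) \<le> \<delta> / 2" for t
    using norm_triangle_ineq [of "y t - y a" "y a - P (X n)"] that a by (simp add: norm_minus_commute)
  have \<Psi>': "\<Psi> (y t) = Ep (y t)" "norm (Ep (y t)) \<le> A" if "norm (y t - y a) \<le> \<delta> / 2" for t
    using near [OF that] \<Psi> [OF K] near_bound [OF _ K near_P, of Ep] by auto
  have "\<epsilon> * A * (b - a) \<le> 1 * A * h"
    using eps eps_small ab A by (intro mult_mono) auto
  also have "\<dots> < \<delta> / 2" using small(2) \<delta> by (simp add: mult_ac)
  finally have lt: "\<epsilon> * A * (b - a) < \<delta> / 2" .
  have speed: "norm (\<epsilon> *\<^sub>R J (\<Psi> (y t))) \<le> \<epsilon> * A" if "norm (y t - y a) \<le> \<delta> / 2" for t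
  proof -
    have "norm (J (\<Psi> (y t))) \<le> A" using \<Psi>' [OF that] order_trans [OF norm_J_le] by simp
    then show ?thesis unfolding norm_scaleR using eps by simp
  qed
  have conf: "norm (y t - y a) \<le> \<epsilon> * A * (t - a)" if "t \<in> {a..b}" for t
    using der speed _ lt that by (rule confined_solution) (use eps A in auto)
  have conf': "norm (y t - y a) \<le> \<epsilon> * A * (b - a)" if t: "t \<in> {a..b}" for t
  proof -
    have "\<epsilon> * A * (t - a) \<le> \<epsilon> * A * (b - a)" using t eps A by (intro mult_left_mono) auto
    with conf [OF t] show ?thesis by linarith
  qed
  have close: "norm (y t - y a) \<le> \<delta> / 2" if "t \<in> {a..b}" for t
    using conf' [OF that] lt by linarith
  show "norm (y b - P (X n)) \<le> \<delta>"
    using close ab near by simp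
  have "norm (y b - y a - (b - a) *\<^sub>R (\<epsilon> *\<^sub>R J (\<Psi> (y a)))) \<le> norm (b - a) * (\<epsilon>\<^sup>2 * A\<^sup>2 * (b - a))"
  proof (rule vector_differentiable_bound_linearization [where S = "{a..b}"])
    fix t assume t: "t \<in> {a..b}"
    have "norm (Ep (y t) - Ep (y a)) \<le> A * norm (P (y t) - P (y a))"
      using near [OF close [OF t]] near [OF close [of a]] ab
      by (intro near_lipschitz [OF _ K] near_P) auto
    also have "\<dots> \<le> A * (\<epsilon> * A * (b - a))"
      using conf' [OF t] norm_P_le [of "y t - y a"] A by (intro mult_left_mono) (auto simp: P_diff)
    finally have "norm (J (Ep (y t) - Ep (y a))) \<le> A * (\<epsilon> * A * (b - a))"
      using norm_J_le order_trans by blast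
    then have "\<epsilon> * norm (J (Ep (y t) - Ep (y a))) \<le> \<epsilon> * (A * (\<epsilon> * A * (b - a)))"
      using eps by (intro mult_left_mono) auto
    then show "norm (\<epsilon> *\<^sub>R J (\<Psi> (y t)) - \<epsilon> *\<^sub>R J (\<Psi> (y a))) \<le> \<epsilon>\<^sup>2 * A\<^sup>2 * (b - a)"
      using \<Psi>' [OF close [OF t]] \<Psi>' [OF close [of a]] ab eps
      by (simp flip: scaleR_diff_right J_diff add: power2_eq_square mult_ac)
  qed (use ab der in \<open>auto simp: closed_segment_eq_real_ivl\<close>)
  then show "norm (y b - y a - ((b - a) * \<epsilon>) *\<^sub>R J (Ep (y a))) \<le> \<epsilon>\<^sup>2 * A\<^sup>2 * (b - a)\<^sup>2"
    using \<Psi>' [OF close [of a]] ab by (simp add: power2_eq_square mult_ac)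
qed

abbreviation Y :: "nat \<Rightarrow> real^3" where "Y n \<equiv> y (real n * h)"

text \<open>Evaluating \<open>Ep\<close> at \<open>X (Suc n)\<close> and not at \<open>q n\<close>
  costs \<open>4 * vel_const A * h\<^sup>2\<close>, harmless after the factor
  \<open>\<epsilon> * h\<close>. The 17 is \<open>4 + 12 + 1\<close>: this cost, the defect of
  \<open>q\<close>, and the local error of the slow flow.\<close>

lemma error_step:
  assumes n: "ok (Suc n)" and a: "norm (P (X n) - Y n) \<le> \<delta> / 2"
  shows "norm (q (Suc n) - Y (Suc n))
    \<le> (1 + A * \<epsilon> * h) * norm (q n - Y n) + \<epsilon> * h * (17 * A\<^sup>2 * drift_const A * h\<^sup>2)"
proof -
  have n': "ok n" by (rule ok_SucD [OF n])
  have K: "X n \<in> K" by (rule in_K_ok [OF n'])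
  let ?e = "norm (q n - Y n)"
  have len: "real (Suc n) * h - real n * h = h" by (simp add: algebra_simps)
  have T: "real (Suc n) * h \<le> c / \<epsilon>"
    using n eps by (simp add: ok_def field_simps)
  have "norm (Y (Suc n) - Y n - (h * \<epsilon>) *\<^sub>R J (Ep (Y n))) \<le> \<epsilon>\<^sup>2 * A\<^sup>2 * h\<^sup>2"
    using y_step(2) [OF n' _ _ T _ a] h unfolding len by simp
  also have "\<dots> = (\<epsilon> * h * A\<^sup>2) * (\<epsilon> * h)" by (simp add: power2_eq_square)
  also have "\<dots> \<le> (\<epsilon> * h * A\<^sup>2) * (h\<^sup>2 * 1)"
    using eps h h_small by (intro mult_left_mono mult_mono) auto
  finally have 1: "norm (Y (Suc n) - Y n - (h * \<epsilon>) *\<^sub>R J (Ep (Y n))) \<le> \<epsilon> * h * (A\<^sup>2 * h\<^sup>2)"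
    by (simp add: mult_ac)
  note q_step_error [OF n]
  also have "\<epsilon>\<^sup>2 * h * (12 * A\<^sup>2 * drift_const A) = (\<epsilon> * h) * ((12 * A\<^sup>2 * drift_const A) * \<epsilon>)" by (simp add: power2_eq_square)
  also have "\<dots> \<le> (\<epsilon> * h) * ((12 * A\<^sup>2 * drift_const A) * h\<^sup>2)"
    using eps h drift_const_bounds by (intro mult_left_mono) auto
  finally have 2: "norm (q (Suc n) - q n - (\<epsilon> * h) *\<^sub>R J (Ep (X (Suc n)))) \<le> (\<epsilon> * h) * (12 * A\<^sup>2 * drift_const A * h\<^sup>2)" .
  have near: "norm (P (Y n) - P (X n)) \<le> \<delta>"
    using a \<delta> by (intro near_P) (auto simp: norm_minus_commute)
  have "norm (Ep (X (Suc n)) - Ep (Y n)) \<le> A * norm (P (X (Suc n)) - P (Y n))"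
    using near near_Suc(1) [OF n'] by (intro near_lipschitz [OF _ K]) auto
  also have "norm (P (X (Suc n)) - P (Y n)) \<le> ?e + 4 * vel_const A * h\<^sup>2"
  proof -
    have "norm (P (X n) - P (Y n)) \<le> norm (P (X n) - Y n)"
      using norm_P_le [of "P (X n) - Y n"] by (simp add: P_diff)
    also have "\<dots> \<le> ?e + norm (q n - P (X n))"
      using norm_triangle_ineq4 [of "q n - Y n" "q n - P (X n)"] by simp
    finally have "norm (P (X n) - P (Y n)) \<le> ?e + 3 * vel_const A * h\<^sup>2"
      using norm_q_diff_le [OF n'] by simp
    then show ?thesis
      using near_Suc(2) [OF n'] norm_triangle_ineq [of "P (X (Suc n)) - P (X n)" "P (X n) - P (Y n)"]
      by simp
  qed
  finally have "norm (Ep (X (Suc n)) - Ep (Y n)) \<le> A * (?e + 4 * vel_const A * h\<^sup>2)"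
    using A by (simp add: mult_left_mono)
  then have "norm (J (Ep (X (Suc n)) - Ep (Y n))) \<le> A * (?e + 4 * vel_const A * h\<^sup>2)"
    using norm_J_le order_trans by blast
  then have "(\<epsilon> * h) * norm (J (Ep (X (Suc n)) - Ep (Y n))) \<le> (\<epsilon> * h) * (A * (?e + 4 * vel_const A * h\<^sup>2))"
    using eps h by (intro mult_left_mono) auto
  then have 3: "norm ((\<epsilon> * h) *\<^sub>R J (Ep (X (Suc n)) - Ep (Y n))) \<le> (\<epsilon> * h) * (A * (?e + 4 * vel_const A * h\<^sup>2))"
    using eps h by simp
  have "q (Suc n) - Y (Suc n) = (q n - Y n) + (\<epsilon> * h) *\<^sub>R J (Ep (X (Suc n)) - Ep (Y n))
      + ((q (Suc n) - q n - (\<epsilon> * h) *\<^sub>R J (Ep (X (Suc n)))) - (Y (Suc n) - Y n - (h * \<epsilon>) *\<^sub>R J (Ep (Y n))))"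
    by (simp add: J_diff scaleR_diff_right mult.commute)
  also have "norm \<dots> \<le> ?e + (\<epsilon> * h) * (A * (?e + 4 * vel_const A * h\<^sup>2))
      + ((\<epsilon> * h) * (12 * A\<^sup>2 * drift_const A * h\<^sup>2) + \<epsilon> * h * (A\<^sup>2 * h\<^sup>2))"
    by (intro norm_triangle_mono order_refl 3 order_trans [OF norm_triangle_ineq4] add_mono 1 2)
  also have "\<dots> = (1 + A * \<epsilon> * h) * ?e + \<epsilon> * h * ((4 * (A * vel_const A) + 12 * A\<^sup>2 * drift_const A + A\<^sup>2) * h\<^sup>2)"
    by (simp add: algebra_simps)
  also have "\<dots> \<le> (1 + A * \<epsilon> * h) * ?e + \<epsilon> * h * (17 * A\<^sup>2 * drift_const A * h\<^sup>2)"
  proof -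
    have "A * vel_const A \<le> A\<^sup>2 * drift_const A" using A A_pow const_bounds by (intro mult_mono) auto
    then have "4 * (A * vel_const A) + 12 * A\<^sup>2 * drift_const A + A\<^sup>2 \<le> 17 * A\<^sup>2 * drift_const A"
      using drift_const_bounds by linarith
    then show ?thesis using eps h by (intro add_left_mono mult_left_mono mult_right_mono) auto
  qed
  finally show ?thesis .
qed

lemma error_const_small: "error_const A * h\<^sup>2 \<le> \<delta> / 2"
proof -
  have "error_const A * h * h \<le> error_const A * h * 1"
    using h h_small A drift_const_bounds unfolding error_const_def by (intro mult_left_mono) auto
  then show ?thesis using small' by (simp add: power2_eq_square mult_ac)
qed

lemma error_bound:
  assumes "ok n" and "\<And>k. k < n \<Longrightarrow> norm (P (X k) - Y k) \<le> \<delta> / 2"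
  shows "norm (P (X n) - Y n) \<le> error_const A * h\<^sup>2"
proof -
  have "norm (q n - Y n) \<le> exp (real n * (A * \<epsilon> * h)) * (norm (q 0 - Y 0)
          + real n * (\<epsilon> * h * (17 * A\<^sup>2 * drift_const A * h\<^sup>2)))"
    using assms eps h A drift_const_bounds
    by (intro discrete_gronwall error_step) (auto intro: ok_mono)
  \<comment> \<open>The 4 covers the start (3 from \<open>q 0\<close>, 1 from \<open>y 0\<close>)
    and the 17 the local errors over the scaled time
    \<open>\<epsilon> * (real n * h) \<le> A\<close>. Returning from \<open>q n\<close> to the
    position adds 3, whence the 24 in \<open>error_const\<close>.\<close>
  also have "\<dots> \<le> exp (A * A) * (4 * (A ^ 3 * drift_const A) * h\<^sup>2 + 17 * (A ^ 3 * drift_const A) * h\<^sup>2)"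
  proof (rule mult_mono)
    have T: "\<epsilon> * (real n * h) \<le> A" using assms(1) A by (simp add: ok_def)
    from mult_left_mono [OF this, of A] A show "exp (real n * (A * \<epsilon> * h)) \<le> exp (A * A)"
      by (simp add: mult_ac)
    have "real n * (\<epsilon> * h * (17 * A\<^sup>2 * drift_const A * h\<^sup>2)) = (\<epsilon> * (real n * h)) * (17 * A\<^sup>2 * drift_const A * h\<^sup>2)"
      by simp
    also have "\<dots> \<le> A * (17 * A\<^sup>2 * drift_const A * h\<^sup>2)"
      using T drift_const_bounds by (intro mult_right_mono) auto
    finally have 1: "real n * (\<epsilon> * h * (17 * A\<^sup>2 * drift_const A * h\<^sup>2)) \<le> 17 * (A ^ 3 * drift_const A) * h\<^sup>2"
      by (simp add: power2_eq_square power3_eq_cube mult_ac)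
    have "norm (q 0 - Y 0) \<le> 3 * vel_const A * h\<^sup>2 + A * \<epsilon>"
      using norm_triangle_ineq [of "q 0 - P (X 0)" "P (X 0) - Y 0"] norm_q_diff_le [OF ok_0] y0 by simp
    also have "\<dots> \<le> 3 * (A ^ 3 * drift_const A) * h\<^sup>2 + (A ^ 3 * drift_const A) * h\<^sup>2"
    proof (intro add_mono mult_right_mono)
      have "1 * vel_const A \<le> A ^ 3 * drift_const A" using A A_pow(1) [of 3] const_bounds by (intro mult_mono) auto
      then show "3 * vel_const A \<le> 3 * (A ^ 3 * drift_const A)" by simp
      have "A * 1 * \<epsilon> \<le> A ^ 3 * drift_const A * h\<^sup>2"
        using A A_pow const_bounds eps by (intro mult_mono) auto
      then show "A * \<epsilon> \<le> A ^ 3 * drift_const A * h\<^sup>2" by simp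
    qed simp
    finally show "norm (q 0 - Y 0) + real n * (\<epsilon> * h * (17 * A\<^sup>2 * drift_const A * h\<^sup>2))
        \<le> 4 * (A ^ 3 * drift_const A) * h\<^sup>2 + 17 * (A ^ 3 * drift_const A) * h\<^sup>2"
      using 1 by linarith
  qed (use eps h drift_const_bounds A in auto)
  finally have 1: "norm (q n - Y n) \<le> exp (A * A) * (21 * (A ^ 3 * drift_const A)) * h\<^sup>2"
    by (simp add: algebra_simps)
  have "1 * (1 * vel_const A) \<le> exp (A * A) * (A ^ 3 * drift_const A)"
    using A A_pow(1) [of 3] const_bounds drift_const_bounds by (intro mult_mono) auto
  then have 2: "3 * vel_const A * h\<^sup>2 \<le> exp (A * A) * (3 * (A ^ 3 * drift_const A)) * h\<^sup>2"
    by (intro mult_right_mono) auto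
  have "norm (P (X n) - Y n) \<le> norm (q n - Y n) + norm (q n - P (X n))"
    using norm_triangle_ineq4 [of "q n - Y n" "q n - P (X n)"] by simp
  also have "\<dots> \<le> exp (A * A) * (21 * (A ^ 3 * drift_const A)) * h\<^sup>2 + exp (A * A) * (3 * (A ^ 3 * drift_const A)) * h\<^sup>2"
    using 1 2 norm_q_diff_le [OF assms(1)] by linarith
  also have "\<dots> = error_const A * h\<^sup>2" by (simp add: error_const_def algebra_simps)
  finally show ?thesis .
qed

text \<open>\<open>error_bound\<close> needs distance at most \<open>\<delta> / 2\<close> at all
  earlier grid points, which its own conclusion provides for small \<open>h\<close>.\<close>

lemma tracking: "ok n \<Longrightarrow> norm (P (X n) - Y n) \<le> error_const A * h\<^sup>2"
proof (induction n rule: less_induct)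
  case (less n)
  have "norm (P (X k) - Y k) \<le> \<delta> / 2" if "k < n" for k
    using less.IH [OF that ok_mono [OF less.prems less_imp_le [OF that]]] error_const_small by linarith
  with less.prems show ?case by (rule error_bound)
qed

text \<open>The last grid point before \<open>t\<close> is tracked, and the rest of the step is too
  short to leave the neighbourhood. Thus a modification of \<open>Ep\<close> away from
  \<open>K\<close> is never felt.\<close>

lemma y_near_K:
  assumes "t \<in> {0..c / \<epsilon>}"
  shows "\<exists>k\<in>K. norm (y t - P k) \<le> \<delta>"
proof -
  define n where "n = nat \<lfloor>t / h\<rfloor>"
  have "0 \<le> t / h" using assms h by simp
  then have "real n = real_of_int \<lfloor>t / h\<rfloor>" unfolding n_def by simp
  then have "real n \<le> t / h" "t / h < real n + 1"
    using floor_correct [of "t / h"] by linarith+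
  then have n: "real n * h \<le> t" "t - real n * h \<le> h"
    using h by (auto simp: field_simps)
  then have "real n * h \<le> c / \<epsilon>" using assms by simp
  then have ok: "ok n" using eps by (simp add: ok_def field_simps)
  have "norm (P (X n) - Y n) \<le> \<delta> / 2" using tracking [OF ok] error_const_small by linarith
  from y_step(1) [OF ok _ n(1) _ n(2) this] have "norm (y t - P (X n)) \<le> \<delta>"
    using assms h by simp
  with in_K_ok [OF ok] show ?thesis by blast
qed

end

section \<open>Existence of slow solutions\<close>

text \<open>Contraction in the supremum norm weighted by \<open>exp (- (\<mu> * t))\<close>, which
  covers \<open>{0..T}\<close> at once, however large \<open>L * T\<close> is. On this interval the
  fixed point is the solution times the weight.\<close>

lemma picard_lindeloef_global:
  fixes F :: "'a::banach \<Rightarrow> 'a"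
  assumes lip: "\<And>p p'. norm (F p - F p') \<le> L * norm (p - p')" and T: "0 \<le> T"
  obtains y where "y 0 = y0"
    and "\<And>t. t \<in> {0..T} \<Longrightarrow> (y has_vector_derivative F (y t)) (at t within {0..T})"
proof -
  \<comment> \<open>Twice the Lipschitz constant gives contraction by \<open>1 / 2\<close>; the
    added 1 keeps \<mu> positive.\<close>
  define \<mu> where "\<mu> = 2 * \<bar>L\<bar> + 1"
  have \<mu>: "0 < \<mu>" "2 * \<bar>L\<bar> \<le> \<mu>" by (auto simp: \<mu>_def)
  have lip': "norm (F p - F p') \<le> \<bar>L\<bar> * norm (p - p')" for p p'
    by (rule order_trans [OF lip mult_right_mono]) auto
  have "\<bar>L\<bar>-lipschitz_on UNIV F"
    by (rule lipschitz_onI) (auto simp: dist_norm lip')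
  then have contF: "continuous_on UNIV F"
    by (rule lipschitz_on_continuous_on)
  define f where "f g s = F (exp (\<mu> * s) *\<^sub>R apply_bcontfun g s)" for g :: "real \<Rightarrow>\<^sub>C 'a" and s
  have contf: "continuous_on S (f g)" for g S
    unfolding f_def
    by (intro continuous_on_compose2 [OF contF] continuous_intros continuous_on_apply_bcontfun) auto
  have int: "f g integrable_on {a..b}" for g a b
    by (intro integrable_continuous_real contf)
  \<comment> \<open>Clipping extends functions on \<open>{0..T}\<close> by constants, so that
    bounded continuous functions on the line serve as the complete space.\<close>
  define clip where "clip t = max 0 (min T t)" for t :: real
  define H where "H g t = exp (- (\<mu> * t)) *\<^sub>R (y0 + integral {0..t} (f g))" for g t
  have clip: "clip t \<in> {0..T}" for t using T by (auto simp: clip_def)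
  have contH: "continuous_on {0..T} (H g)" for g
    unfolding H_def by (intro continuous_intros indefinite_integral_continuous_1 int)
  have mem: "(\<lambda>t. H g (clip t)) \<in> bcontfun" for g
  proof -
    have "continuous_on UNIV clip" unfolding clip_def by (intro continuous_intros)
    then have "continuous_on UNIV (\<lambda>t. H g (clip t))"
      using continuous_on_compose2 [OF contH] clip by blast
    moreover have "compact (H g ` {0..T})"
      by (intro compact_continuous_image contH) simp
    then obtain b where "\<And>x. x \<in> H g ` {0..T} \<Longrightarrow> norm x \<le> b"
      using compact_imp_bounded bounded_iff by metis
    ultimately show ?thesis using clip by (intro bcontfun_normI [where b = b]) auto
  qed
  define \<Phi> where "\<Phi> g = Bcontfun (\<lambda>t. H g (clip t))" for g
  have \<Phi>: "apply_bcontfun (\<Phi> g) t = H g (clip t)" for g t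
    unfolding \<Phi>_def by (simp add: Bcontfun_inverse mem)
  have contract: "dist (\<Phi> g) (\<Phi> g') \<le> 1 / 2 * dist g g'" for g g'
  proof (rule dist_bound)
    fix t
    let ?c = "clip t" and ?d = "dist g g'"
    have "((\<lambda>s. exp (\<mu> * s)) has_integral exp (\<mu> * ?c) / \<mu> - exp (\<mu> * 0) / \<mu>) {0..?c}"
      using clip [of t] \<mu>
      by (intro fundamental_theorem_of_calculus) (auto intro!: derivative_eq_intros simp flip: has_real_derivative_iff_has_vector_derivative)
    from has_integral_mult_right [OF this, of "\<bar>L\<bar> * ?d"]
    have I: "((\<lambda>s. \<bar>L\<bar> * ?d * exp (\<mu> * s)) has_integral \<bar>L\<bar> * ?d * (exp (\<mu> * ?c) / \<mu> - 1 / \<mu>)) {0..?c}"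
      by simp
    have le: "norm (f g s - f g' s) \<le> \<bar>L\<bar> * ?d * exp (\<mu> * s)" for s
    proof -
      have "norm (f g s - f g' s) \<le> \<bar>L\<bar> * norm (exp (\<mu> * s) *\<^sub>R (apply_bcontfun g s - apply_bcontfun g' s))"
        unfolding f_def scaleR_diff_right by (rule lip')
      also have "\<dots> = \<bar>L\<bar> * (exp (\<mu> * s) * dist (apply_bcontfun g s) (apply_bcontfun g' s))"
        by (simp add: dist_norm)
      also have "\<dots> \<le> \<bar>L\<bar> * (exp (\<mu> * s) * ?d)"
        by (intro mult_left_mono dist_bounded) auto
      finally show ?thesis by (simp add: mult_ac)
    qed
    have "H g ?c - H g' ?c = exp (- (\<mu> * ?c)) *\<^sub>R integral {0..?c} (\<lambda>s. f g s - f g' s)"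
      unfolding H_def integral_diff [OF int int] by (simp add: algebra_simps)
    then have "dist (H g ?c) (H g' ?c) = exp (- (\<mu> * ?c)) * norm (integral {0..?c} (\<lambda>s. f g s - f g' s))"
      by (simp add: dist_norm)
    also have "\<dots> \<le> exp (- (\<mu> * ?c)) * (\<bar>L\<bar> * ?d * (exp (\<mu> * ?c) / \<mu> - 1 / \<mu>))"
    proof (rule mult_left_mono)
      have "norm (integral {0..?c} (\<lambda>s. f g s - f g' s)) \<le> integral {0..?c} (\<lambda>s. \<bar>L\<bar> * ?d * exp (\<mu> * s))"
        using le by (intro integral_norm_bound_integral integrable_diff int has_integral_integrable [OF I])
      then show "norm (integral {0..?c} (\<lambda>s. f g s - f g' s)) \<le> \<bar>L\<bar> * ?d * (exp (\<mu> * ?c) / \<mu> - 1 / \<mu>)"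
        by (simp only: integral_unique [OF I])
    qed simp
    also have "\<dots> = \<bar>L\<bar> / \<mu> * ?d * (1 - exp (- (\<mu> * ?c)))"
      using \<mu> by (simp add: field_simps exp_minus)
    also have "\<dots> \<le> 1 / 2 * ?d * 1"
      using \<mu> clip [of t] by (intro mult_mono) (auto simp: field_simps)
    finally show "dist (apply_bcontfun (\<Phi> g) t) (apply_bcontfun (\<Phi> g') t) \<le> 1 / 2 * ?d"
      by (simp add: \<Phi>)
  qed
  obtain g where g: "\<Phi> g = g"
    using banach_fix_type [of "1 / 2" \<Phi>] contract by auto
  define y where "y t = y0 + integral {0..t} (f g)" for t
  have y: "f g t = F (y t)" if "t \<in> {0..T}" for t
  proof -
    have "clip t = t" using that by (auto simp: clip_def)
    then have "apply_bcontfun g t = H g t" using \<Phi> [of g t] g by simp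
    then show ?thesis unfolding f_def by (simp add: H_def y_def exp_minus)
  qed
  show thesis
  proof (rule that)
    show "y 0 = y0" by (simp add: y_def)
    fix t assume t: "t \<in> {0..T}"
    have "(y has_vector_derivative 0 + f g t) (at t within {0..T})"
      unfolding y_def by (intro has_vector_derivative_add has_vector_derivative_const
          integral_has_vector_derivative contf t)
    then show "(y has_vector_derivative F (y t)) (at t within {0..T})"
      by (simp add: y [OF t])
  qed
qed

section \<open>Bounds and Lipschitz constants drawn from smoothness\<close>

lemma smooth_has_derivative:
  assumes "smooth f"
  shows "(f has_derivative frechet_derivative f (at x)) (at x)"
proof -
  have "iter_deriv f [] differentiable (at x)" using assms unfolding smooth_def by blast
  then show ?thesis by (simp add: frechet_derivative_works)
qed

text \<open>Each directional derivative is differentiable, hence continuous and bounded on the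
  compact ball, with a bound that depends on the direction; expansion in the basis yields one
  operator bound.\<close>

lemma smooth_lipschitz_cball:
  fixes f :: "'a::euclidean_space \<Rightarrow> 'b::real_normed_vector"
  assumes f: "smooth f"
  obtains L where "\<And>x y. x \<in> cball a R \<Longrightarrow> y \<in> cball a R \<Longrightarrow> norm (f x - f y) \<le> L * norm (x - y)"
proof -
  have "\<exists>B. \<forall>x\<in>cball a R. norm (frechet_derivative f (at x) v) \<le> B" for v
  proof -
    have "iter_deriv f [v] differentiable (at x)" for x
      using f unfolding smooth_def by blast
    then have "continuous_on (cball a R) (\<lambda>x. frechet_derivative f (at x) v)"
      by (auto intro!: continuous_at_imp_continuous_on differentiable_imp_continuous_within)
    then have "bounded ((\<lambda>x. frechet_derivative f (at x) v) ` cball a R)"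
      by (intro compact_imp_bounded compact_continuous_image) auto
    then show ?thesis by (auto simp: bounded_iff)
  qed
  then obtain B where B: "\<And>v x. x \<in> cball a R \<Longrightarrow> norm (frechet_derivative f (at x) v) \<le> B v"
    by metis
  have "norm (f x - f y) \<le> (\<Sum>b\<in>Basis. B b) * norm (x - y)" if "x \<in> cball a R" "y \<in> cball a R" for x y
  proof (rule differentiable_bound [OF convex_cball _ _ that])
    fix x assume x: "x \<in> cball a R"
    let ?D = "frechet_derivative f (at x)"
    show "(f has_derivative ?D) (at x within cball a R)"
      by (rule has_derivative_at_withinI [OF smooth_has_derivative [OF f]])
    have lin: "linear ?D"
      using smooth_has_derivative [OF f] by (rule has_derivative_linear)
    show "onorm ?D \<le> (\<Sum>b\<in>Basis. B b)"
    proof (rule onorm_le)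
      fix v
      have "?D v = ?D (\<Sum>b\<in>Basis. (v \<bullet> b) *\<^sub>R b)"
        by (simp add: euclidean_representation)
      also have "\<dots> = (\<Sum>b\<in>Basis. (v \<bullet> b) *\<^sub>R ?D b)"
        by (simp add: linear_sum [OF lin] linear_cmul [OF lin])
      finally have "norm (?D v) \<le> (\<Sum>b\<in>Basis. norm ((v \<bullet> b) *\<^sub>R ?D b))"
        by (simp only: norm_sum)
      also have "\<dots> \<le> (\<Sum>b\<in>Basis. norm v * B b)"
        unfolding norm_scaleR using B [OF x] by (intro sum_mono mult_mono) (auto simp: Basis_le_norm)
      finally show "norm (?D v) \<le> (\<Sum>b\<in>Basis. B b) * norm v"
        by (simp add: sum_distrib_left mult.commute)
    qed
  qed
  then show thesis by (rule that)
qed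

text \<open>The neighbourhood of \<open>K\<close> may fail to be convex, so the mean value
  inequality is used on a single ball around \<open>p\<close>.\<close>

lemma derivs_bounded_on_cball:
  fixes F :: "'a::euclidean_space \<Rightarrow> 'b::real_normed_vector"
  assumes F: "smooth F" "derivs_bounded_on (closed_nbhd \<delta> K) M F" and p: "p \<in> K"
  shows "a \<in> cball p \<delta> \<Longrightarrow> norm (F a) \<le> M 0"
    and "a \<in> cball p \<delta> \<Longrightarrow> b \<in> cball p \<delta> \<Longrightarrow> norm (F a - F b) \<le> M 1 * norm (a - b)"
proof -
  have bd: "norm (iter_deriv F vs x) \<le> M (length vs) * prod_list (map norm vs)" if "x \<in> cball p \<delta>" for x vs
    using F(2) p that unfolding derivs_bounded_on_def closed_nbhd_def by blast
  show "norm (F a) \<le> M 0" if "a \<in> cball p \<delta>"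
    using bd [OF that, of "[]"] by simp
  show "norm (F a - F b) \<le> M 1 * norm (a - b)" if ab: "a \<in> cball p \<delta>" "b \<in> cball p \<delta>"
  proof (rule differentiable_bound [OF convex_cball _ _ ab])
    fix x assume x: "x \<in> cball p \<delta>"
    show "(F has_derivative frechet_derivative F (at x)) (at x within cball p \<delta>)"
      by (rule has_derivative_at_withinI [OF smooth_has_derivative [OF F(1)]])
    show "onorm (frechet_derivative F (at x)) \<le> M 1"
    proof (rule onorm_le)
      show "norm (frechet_derivative F (at x) v) \<le> M 1 * norm v" for v
        using bd [OF x, of "[v]"] by simp
    qed
  qed
qed

text \<open>The points may be far from \<open>p\<close> along \<open>B0\<close>. Translation to the
  parallel coordinate of \<open>p\<close>, which \<open>F\<close> does not notice, brings them into
  the ball around \<open>p\<close>.\<close>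

lemma (in unit_direction) perp_only_near:
  assumes F: "perp_only B0 F" "smooth F" "derivs_bounded_on (closed_nbhd \<delta> K) M F"
    and p: "p \<in> K" and a: "norm (P a - P p) \<le> \<delta>"
  shows "norm (F a) \<le> M 0"
    and "norm (P b - P p) \<le> \<delta> \<Longrightarrow> norm (F a - F b) \<le> M 1 * norm (P a - P b)"
proof -
  define shift where "shift b = p + (P b - P p)" for b
  have eq: "F (shift b) = F b" for b
  proof -
    have "P (shift b) = P b" by (simp add: shift_def P_add P_diff)
    then show ?thesis using F(1) unfolding perp_only_def by metis
  qed
  have mem: "shift b \<in> cball p \<delta>" if "norm (P b - P p) \<le> \<delta>" for b
    using that by (simp add: shift_def dist_norm norm_minus_commute)
  show "norm (F a) \<le> M 0"
    using derivs_bounded_on_cball(1) [OF F(2,3) p mem [OF a]] by (simp add: eq)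
  show "norm (F a - F b) \<le> M 1 * norm (P a - P b)" if "norm (P b - P p) \<le> \<delta>"
    using derivs_bounded_on_cball(2) [OF F(2,3) p mem [OF a] mem [OF that]]
    by (simp add: eq) (simp add: shift_def)
qed

text \<open>The velocity at a grid point is the mean of the adjacent half-step velocities, and
  \<open>V 0 - v0\<close> is \<open>h / 2\<close> times the second difference quotient at index 0;
  this eliminates \<open>x (-1)\<close>.\<close>

lemma boris_half_steps:
  assumes sol: "boris_solution h B E x0 v0 x" and h: "0 < h"
    and V: "\<And>n::nat. V n = (1 / h) *\<^sub>R (x (int (Suc n)) - x (int n))"
  shows "x 0 = x0"
    and "V 0 = v0 + (h / 2) *\<^sub>R (cross3 v0 (B (x 0)) + E (x 0))"
    and "V (Suc n) - V n = h *\<^sub>R (cross3 ((1 / 2) *\<^sub>R (V (Suc n) + V n)) (B (x (int (Suc n)))) + E (x (int (Suc n))))"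
proof -
  have eq: "cross3 (boris_velocity h x m) (B (x m)) + E (x m)
      = (1 / h\<^sup>2) *\<^sub>R (x (m + 1) - 2 *\<^sub>R x m + x (m - 1))" if "0 \<le> m" for m
    using sol that by (simp add: boris_solution_def)
  have v0: "v0 = boris_velocity h x 0" and "x 0 = x0" using sol by (auto simp: boris_solution_def)
  then show "x 0 = x0" by simp
  have half: "(h / 2) *\<^sub>R (1 / h\<^sup>2) *\<^sub>R a = (1 / (2 * h)) *\<^sub>R a" "h *\<^sub>R (1 / h\<^sup>2) *\<^sub>R a = (1 / h) *\<^sub>R a" for a :: "real^3"
    using h by (auto simp: power2_eq_square)
  show "V 0 = v0 + (h / 2) *\<^sub>R (cross3 v0 (B (x 0)) + E (x 0))"
    unfolding v0 eq [OF order_refl] half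
    unfolding V boris_velocity_def using h by (simp add: vec_eq_iff field_simps)
  have "boris_velocity h x (int (Suc n)) = (1 / 2) *\<^sub>R (V (Suc n) + V n)"
    unfolding V boris_velocity_def using h by (simp add: vec_eq_iff field_simps)
  moreover have "V (Suc n) - V n = (1 / h) *\<^sub>R (x (int (Suc n) + 1) - 2 *\<^sub>R x (int (Suc n)) + x (int (Suc n) - 1))"
    unfolding V using h by (simp add: vec_eq_iff field_simps)
  ultimately show "V (Suc n) - V n = h *\<^sub>R (cross3 ((1 / 2) *\<^sub>R (V (Suc n) + V n)) (B (x (int (Suc n)))) + E (x (int (Suc n))))"
    using eq [of "int (Suc n)"] h by (simp add: power2_eq_square)
qed

text \<open>\<open>Ep\<close> has no given bounds far from \<open>K\<close>. Composed with the
  nearest-point projection onto a ball containing the \<delta>-neighbourhood of the projected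
  \<open>K\<close>, it becomes globally Lipschitz, and by \<open>y_near_K\<close> the solution stays
  where both fields agree.\<close>

lemma (in boris_run) slow_solution_exists:
  assumes "error_const A * h \<le> \<delta> / 2" and "norm (P (X 0) - y0) \<le> A * \<epsilon>" and "smooth Ep"
  shows "\<exists>y. slow_solution \<epsilon> B0 Ep y0 (c / \<epsilon>) y"
proof -
  obtain L where L: "\<And>a b. a \<in> cball 0 (A + \<delta>) \<Longrightarrow> b \<in> cball 0 (A + \<delta>) \<Longrightarrow> norm (Ep a - Ep b) \<le> L * norm (a - b)"
    using smooth_lipschitz_cball [OF assms(3)] by blast
  define proj where "proj = closest_point (cball (0 :: real^3) (A + \<delta>))"
  define \<Psi> where "\<Psi> p = Ep (proj p)" for p
  have ne: "cball (0 :: real^3) (A + \<delta>) \<noteq> {}" using A \<delta> by simp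
  have proj: "proj p \<in> cball 0 (A + \<delta>)" for p
    unfolding proj_def by (rule closest_point_in_set [OF closed_cball ne])
  have \<Psi>: "\<Psi> p = Ep p" if "k \<in> K" "norm (p - P k) \<le> \<delta>" for p k
  proof -
    have "norm p \<le> A + \<delta>"
      using norm_triangle_ineq [of "p - P k" "P k"] that norm_P_le [of k] K_le [OF that(1)] by simp
    then have "proj p = p" unfolding proj_def by (intro closest_point_self) simp
    then show ?thesis by (simp add: \<Psi>_def)
  qed
  have "norm (\<epsilon> *\<^sub>R J (\<Psi> p) - \<epsilon> *\<^sub>R J (\<Psi> p')) \<le> (\<epsilon> * \<bar>L\<bar>) * norm (p - p')" for p p'
  proof -
    have "norm (J (\<Psi> p - \<Psi> p')) \<le> norm (\<Psi> p - \<Psi> p')" by (rule norm_J_le)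
    also have "\<dots> \<le> L * norm (proj p - proj p')" unfolding \<Psi>_def by (rule L [OF proj proj])
    also have "\<dots> \<le> \<bar>L\<bar> * norm (p - p')"
      using closest_point_lipschitz [OF convex_cball closed_cball ne, of p p']
      by (intro mult_mono) (auto simp: proj_def dist_norm)
    finally show ?thesis
      using eps by (simp flip: scaleR_diff_right J_diff add: mult.assoc)
  qed
  from picard_lindeloef_global [OF this] obtain y where sol: "y 0 = y0"
    "\<And>t. t \<in> {0..c / \<epsilon>} \<Longrightarrow> (y has_vector_derivative \<epsilon> *\<^sub>R J (\<Psi> (y t))) (at t within {0..c / \<epsilon>})"
    using c eps by (metis less_imp_le divide_pos_pos)
  interpret boris_tracking B0 K \<delta> c A \<epsilon> h B1 B2 Ep Epar E2 X v0 V y \<Psi>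
    by unfold_locales (use assms sol \<Psi> in auto)
  have "\<Psi> (y t) = Ep (y t)" if "t \<in> {0..c / \<epsilon>}" for t
    using y_near_K [OF that] \<Psi> by blast
  with sol have "slow_solution \<epsilon> B0 Ep y0 (c / \<epsilon>) y"
    unfolding slow_solution_def by (auto simp del: atLeastAtMost_iff)
  then show ?thesis by blast
qed

theorem theorem6p2:
  fixes B0 :: "real^3" and K :: "(real^3) set" and M :: "nat \<Rightarrow> real"
    and \<delta> c c1 V :: real
  assumes "norm B0 = 1" and "compact K" and "\<delta> > 0" and "c > 0"
  shows "\<exists>C h0. h0 > 0 \<and>
    (\<forall>\<epsilon> h B1 B2 Eperp Epar E2 q u x0 v0 x.
       0 < \<epsilon> \<and> \<epsilon> \<le> h\<^sup>2 \<and> 0 < h \<and> h \<le> h0 \<and>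
       admissible_fields B0 (closed_nbhd \<delta> K) M B1 B2 Eperp Epar E2 \<and>
       norm q \<le> V \<and> norm u \<le> V \<and>
       (x0 = q \<or> x0 = q + \<epsilon> *\<^sub>R cross3 u B0) \<and>
       norm v0 \<le> V \<and> norm (P_perp B0 v0) \<le> c1 * \<epsilon> \<and>
       boris_solution h (magnetic_field \<epsilon> B0 B1 B2) (electric_field \<epsilon> Eperp Epar E2) x0 v0 x \<and>
       (\<forall>n::nat. real n * h \<le> c / \<epsilon> \<longrightarrow> x (int n) \<in> K)
       \<longrightarrow>
       (\<exists>y. slow_solution \<epsilon> B0 Eperp (P_perp B0 q) (c / \<epsilon>) y) \<and>
       (\<forall>y. slow_solution \<epsilon> B0 Eperp (P_perp B0 q) (c / \<epsilon>) y \<longrightarrow>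
         (\<forall>n::nat. real n * h \<le> c / \<epsilon> \<longrightarrow>
            norm (P_perp B0 (x (int n)) - y (real n * h)) \<le> C * h\<^sup>2)))"
proof -
  interpret unit_direction B0 by unfold_locales (rule assms)
  obtain b where b: "\<And>p. p \<in> K \<Longrightarrow> norm p \<le> b"
    using compact_imp_bounded [OF assms(2)] bounded_iff by metis
  \<comment> \<open>Fixed before \<epsilon>, \<open>h\<close> and the fields are chosen; absolute
    values because the data may have any sign.\<close>
  define A where "A = 1 + \<bar>M 0\<bar> + \<bar>M 1\<bar> + \<bar>V\<bar> + \<bar>c\<bar> + \<bar>c1\<bar> + \<bar>b\<bar>"
  have A_ge: "1 \<le> A" "M 0 \<le> A" "M 1 \<le> A" "V \<le> A" "c \<le> A" "c1 \<le> A" "b \<le> A"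
    unfolding A_def by auto
  have pos: "0 < drift_const A" "0 < error_const A" using A_ge(1) by (auto simp: drift_const_def error_const_def vel_const_def rem_const_def)
  \<comment> \<open>The entries give, in turn, the two conditions \<open>small\<close> and the
    condition \<open>small'\<close>.\<close>
  define h0 where "h0 = min (1 / drift_const A) (min (\<delta> / (18 * A)) (\<delta> / (2 * error_const A)))"
  have "0 < h0" using pos A_ge(1) assms(3) by (simp add: h0_def)
  moreover have "(\<exists>y. slow_solution \<epsilon> B0 Eperp (P_perp B0 q) (c / \<epsilon>) y) \<and>
       (\<forall>y. slow_solution \<epsilon> B0 Eperp (P_perp B0 q) (c / \<epsilon>) y \<longrightarrow>
         (\<forall>n::nat. real n * h \<le> c / \<epsilon> \<longrightarrow>
            norm (P_perp B0 (x (int n)) - y (real n * h)) \<le> error_const A * h\<^sup>2))"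
    if H: "0 < \<epsilon>" "\<epsilon> \<le> h\<^sup>2" "0 < h" "h \<le> h0"
       "admissible_fields B0 (closed_nbhd \<delta> K) M B1 B2 Eperp Epar E2"
       "norm q \<le> V" "norm u \<le> V" "x0 = q \<or> x0 = q + \<epsilon> *\<^sub>R cross3 u B0"
       "norm v0 \<le> V" "norm (P_perp B0 v0) \<le> c1 * \<epsilon>"
       "boris_solution h (magnetic_field \<epsilon> B0 B1 B2) (electric_field \<epsilon> Eperp Epar E2) x0 v0 x"
       "\<forall>n::nat. real n * h \<le> c / \<epsilon> \<longrightarrow> x (int n) \<in> K"
    for \<epsilon> h B1 B2 Eperp Epar E2 q u x0 v0 x
  proof -
    have small_h: "h * drift_const A \<le> 1" "h * (18 * A) \<le> \<delta>" "error_const A * h \<le> \<delta> / 2"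
      using H(4) pos A_ge(1) unfolding h0_def by (auto simp: field_simps)
    define W where "W n = (1 / h) *\<^sub>R (x (int (Suc n)) - x (int n))" for n
    note half = boris_half_steps [OF H(11,3) W_def]
    have fields: "smooth F \<and> derivs_bounded_on (closed_nbhd \<delta> K) M F" if "F \<in> {B1, B2, Eperp, Epar, E2}" for F
      using H(5) that unfolding admissible_fields_def by blast
    have perp: "perp_only B0 F" if "F \<in> {B1, Eperp}" for F
      using H(5) that unfolding admissible_fields_def by blast
    have sA: "m * r \<le> A * r" if "m \<le> A" "0 \<le> r" for m r
      using that by (rule mult_right_mono)
    interpret boris_run B0 K \<delta> c A \<epsilon> h B1 B2 Eperp Epar E2 "\<lambda>n. x (int n)" v0 W
    proof unfold_locales
      show "x (int (Suc n)) - x (int n) = h *\<^sub>R W n" for n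
        using H(3) by (simp add: W_def)
      show "norm p \<le> A" if "p \<in> K" for p using b [OF that] A_ge by linarith
      show "norm (F a) \<le> A" if "F \<in> {B1, Eperp}" "p \<in> K" "norm (P a - P p) \<le> \<delta>" for F p a
        using perp_only_near(1) [OF perp [OF that(1)] _ _ that(2,3)] fields [of F] that(1) A_ge(2)
        by fastforce
      show "norm (F a - F b) \<le> A * norm (P a - P b)"
        if "F \<in> {B1, Eperp}" "p \<in> K" "norm (P a - P p) \<le> \<delta>" "norm (P b - P p) \<le> \<delta>" for F p a b
        using perp_only_near(2) [OF perp [OF that(1)] _ _ that(2-4)] fields [of F] that(1)
          sA [OF A_ge(3), of "norm (P a - P b)"] by fastforce
      show "norm (F p) \<le> A" if "F \<in> {B2, Epar, E2}" "p \<in> K" for F p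
        using derivs_bounded_on_cball(1) [of F \<delta> K M p p] fields [of F] that A_ge(2) assms(3) by fastforce
      show "Eperp a \<bullet> B0 = 0" "cross3 (Epar a) B0 = 0" for a
        using H(5) unfolding admissible_fields_def by auto
      show "x (int n) \<in> K" if "\<epsilon> * (real n * h) \<le> c" for n
        using H(1,12) that by (simp add: field_simps)
      show "norm (P v0) \<le> A * \<epsilon>" using H(10) sA [OF A_ge(6), of \<epsilon>] H(1) by linarith
      show "W 0 = v0 + (h / 2) *\<^sub>R (cross3 v0 (magnetic_field \<epsilon> B0 B1 B2 (x (int 0)))
          + electric_field \<epsilon> Eperp Epar E2 (x (int 0)))"
        using half(2) by simp
    qed (use A_ge H small_h assms half(3) in auto)
    have start: "norm (P (x (int 0)) - P q) \<le> A * \<epsilon>"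
      using H(8)
    proof
      assume "x0 = q"
      then show ?thesis using half(1) A_ge H(1) by simp
    next
      assume "x0 = q + \<epsilon> *\<^sub>R cross3 u B0"
      then have "P (x (int 0)) - P q = \<epsilon> *\<^sub>R J u"
        using half(1) by (simp add: P_add P_scaleR)
      moreover have "norm (J u) \<le> A" using norm_J_le [of u] H(7) A_ge(4) by linarith
      then have "\<epsilon> * norm (J u) \<le> \<epsilon> * A" using H(1) by (intro mult_left_mono) auto
      ultimately show ?thesis using H(1) by (simp add: mult.commute)
    qed
    have "norm (P (x (int n)) - y (real n * h)) \<le> error_const A * h\<^sup>2"
      if sol: "slow_solution \<epsilon> B0 Eperp (P q) (c / \<epsilon>) y" and n: "real n * h \<le> c / \<epsilon>" for y n
    proof -
      interpret boris_tracking B0 K \<delta> c A \<epsilon> h B1 B2 Eperp Epar E2 "\<lambda>n. x (int n)" v0 W y Eperp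
        by unfold_locales (use small_h(3) start sol in \<open>auto simp: slow_solution_def\<close>)
      show ?thesis
        using tracking [of n] n H(1) by (simp add: ok_def field_simps)
    qed
    moreover have "\<exists>y. slow_solution \<epsilon> B0 Eperp (P q) (c / \<epsilon>) y"
      using small_h(3) start fields by (intro slow_solution_exists) auto
    ultimately show ?thesis by blast
  qed
  ultimately show ?thesis by (intro exI [of _ "error_const A"] exI [of _ h0]) blast
qed

end
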